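(* Let $(u_j)_{j\ge1}$ and $(v_j)_{j\ge1}$ be sequences of complex numbers. Then for any $n\ge1$ and any $k=0,\dots,n-1$, \[\frac{(-1)^{n-1}}{(n-1)!} \sum_{\substack{ \sigma, \tau\in P(n) \\ \sigma\vee \tau=1_n \\ |\sigma|+|\tau|=n+1-k}} \mu(0_n,\sigma)\mu(0_n,\tau) u_\sigma v_\tau = (-1)^k \sum_{g=0}^{\lfloor k/2\rfloor} s_k^{(g)},\] where \[s_k^{(g)} = \sum_{\substack{\zeta \vdash n\\ \ell(\zeta) = k+1-2g}} \frac{n}{\prod_{i=1}^{\ell(\zeta)} \zeta_i \prod_{i=1}^n t_i^\zeta!} \sum_{\alpha \in S^{(g)}_{NC}[\zeta]} u_\alpha v_{\alpha^{-1}\gamma_\zeta}.\]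
   Context: $P(n)$ is the lattice of set partitions of $\{1,\dots,n\}$ under refinement, with minimum $0_n$, maximum $1_n$, join $\vee$, $|\pi|$ the number of blocks, and Möbius function $\mu(0_n,\pi)=(-1)^{n-|\pi|}\prod_{V\in\pi}(|V|-1)!$. For a sequence $(u_j)$, $u_\pi=\prod_{V\in\pi}u_{|V|}$, and for a permutation $\alpha\in S_n$, $u_\alpha=u_{f(\alpha)}$ where $f(\alpha)\in P(n)$ is the partition into cycles (orbits) of $\alpha$; $\#(\alpha)$ is the number of cycles. For an integer partition $\zeta=[\zeta_1,\dots,\zeta_m]\vdash n$ ($\zeta_1\ge\dots\ge\zeta_m\ge1$), $\ell(\zeta)=m$ is its number of parts, $t_i^\zeta$ is the number of parts equal to $i$, and $\gamma_\zeta=(1,\dots,\zeta_1)(\zeta_1+1,\dots,\zeta_1+\zeta_2)\cdots(\zeta_1+\dots+\zeta_{m-1}+1,\dots,n)\in S_n$. For $\alpha,\gamma\in S_n$ such that the subgroup generated by $\alpha$ and $\gamma$ acts transitively on $\{1,\dots,n\}$, the genus of $\alpha$ relative to $\gamma$ is the integer $g\ge0$ with $\#(\alpha)+\#(\alpha^{-1}\gamma)+\#(\gamma)=n+2(1-g)$ (equivalently, the minimal genus of a closed oriented surface carrying a suitable cellular embedding of the map determined by $\alpha,\gamma$). $S^{(g)}_{NC}[\zeta]$ is the set of $\alpha\in S_n$ such that the subgroup generated by $\alpha$ and $\gamma_\zeta$ acts transitively on $\{1,\dots,n\}$ and $\alpha$ has genus $g$ relative to $\gamma_\zeta$. *)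

theory Defs
  imports Complex_Main "HOL-Library.Disjoint_Sets" "HOL-Algebra.Lattice"
    "HOL-Algebra.Sym_Groups" "HOL-Combinatorics.Orbits"
begin

section \<open>The lattice of set partitions\<close>

definition set_partitions :: "nat \<Rightarrow> nat set set gorder" where
  "set_partitions n =
    \<lparr>carrier = {p. partition_on {1..n} p}, eq = (=), le = refines {1..n}\<rparr>"

lemma partial_order_set_partitions: "partial_order (set_partitions n)"
  by unfold_locales
    (auto simp: set_partitions_def refines_refl dest: refines_asym intro: refines_trans)

lemma finite_set_partitions: "finite (carrier (set_partitions n))"
  by (simp add: set_partitions_def finitely_many_partition_on)

text \<open>
  The Moebius function of a finite partially ordered set, given by \<open>\<mu> x x = 1\<close> and
  \<open>(\<Sum>z | x \<sqsubseteq> z \<and> z \<sqsubseteq> y. \<mu> x z) = 0\<close> for \<open>x \<sqsubset> y\<close>. It takes the dummy value 0 if the order is not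
  a finite partial order or if \<open>x \<sqsubseteq> y\<close> fails. On \<open>set_partitions n\<close> its value from the minimum
  to \<open>p\<close> is the familiar \<open>(-1) ^ (n - card p) * (\<Prod>V\<in>p. fact (card V - 1))\<close>.
\<close>
function moebius :: "('a, 'b) gorder_scheme \<Rightarrow> 'a \<Rightarrow> 'a \<Rightarrow> int" where
  "moebius L x y =
    (if partial_order L \<and> finite (carrier L) \<and> x \<in> carrier L \<and> y \<in> carrier L \<and> x \<sqsubseteq>\<^bsub>L\<^esub> y
     then if x = y then 1
          else - (\<Sum>z \<in> {z \<in> carrier L. x \<sqsubseteq>\<^bsub>L\<^esub> z \<and> z \<sqsubset>\<^bsub>L\<^esub> y}. moebius L x z)
     else 0)"
  by pat_completeness auto
termination
proof (relation "measure (\<lambda>(L, x, y). card {z \<in> carrier L. z \<sqsubset>\<^bsub>L\<^esub> y})", goal_cases)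
  case 1
  show ?case by simp
next
  case (2 L x y z)
  then interpret partial_order L by simp
  have z: "z \<in> carrier L" "z \<sqsubset>\<^bsub>L\<^esub> y" and y: "y \<in> carrier L" and fin: "finite (carrier L)"
    using 2 by auto
  have "{w \<in> carrier L. w \<sqsubset>\<^bsub>L\<^esub> z} \<subset> {w \<in> carrier L. w \<sqsubset>\<^bsub>L\<^esub> y}"
    using z y by (auto simp: lless_eq dest: le_antisym intro: le_trans)
  then show ?case
    using fin by (auto intro!: psubset_card_mono)
qed

declare moebius.simps [simp del]

definition block_prod :: "(nat \<Rightarrow> complex) \<Rightarrow> nat set set \<Rightarrow> complex" where
  "block_prod u p = (\<Prod>V\<in>p. u (card V))"


section \<open>Permutations\<close>

text \<open>The fixed points of a permutation count as cycles of length 1.\<close>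
definition cycle_partition :: "nat \<Rightarrow> (nat \<Rightarrow> nat) \<Rightarrow> nat set set" where
  "cycle_partition n \<alpha> = Orbits.orbit \<alpha> ` {1..n}"

definition num_cycles :: "nat \<Rightarrow> (nat \<Rightarrow> nat) \<Rightarrow> nat" where
  "num_cycles n \<alpha> = card (cycle_partition n \<alpha>)"

definition transitive_pair :: "nat \<Rightarrow> (nat \<Rightarrow> nat) \<Rightarrow> (nat \<Rightarrow> nat) \<Rightarrow> bool" where
  "transitive_pair n \<alpha> \<gamma> \<longleftrightarrow>
    (\<forall>i\<in>{1..n}. \<forall>j\<in>{1..n}. \<exists>\<phi>\<in>generate (sym_group n) {\<alpha>, \<gamma>}. \<phi> i = j)"

text \<open>
  The product of permutations is composition of functions. The opposite convention would replace
  \<open>\<alpha>\<^sup>-\<^sup>1\<gamma>\<close> by its conjugate \<open>\<gamma>\<alpha>\<^sup>-\<^sup>1\<close>, which has the same cycle type.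
\<close>
definition has_genus :: "nat \<Rightarrow> (nat \<Rightarrow> nat) \<Rightarrow> (nat \<Rightarrow> nat) \<Rightarrow> nat \<Rightarrow> bool" where
  "has_genus n \<gamma> \<alpha> g \<longleftrightarrow>
    int (num_cycles n \<alpha>) + int (num_cycles n (inv_into UNIV \<alpha> \<circ> \<gamma>)) + int (num_cycles n \<gamma>)
      = int n + 2 * (1 - int g)"


section \<open>Integer partitions\<close>

definition int_partitions :: "nat \<Rightarrow> nat list set" where
  "int_partitions n = {\<zeta>. sorted_wrt (\<ge>) \<zeta> \<and> (\<forall>i\<in>set \<zeta>. 1 \<le> i) \<and> sum_list \<zeta> = n}"

text \<open>The product of the cycles of lengths \<open>\<zeta>\<close> on the consecutive intervals following \<open>s\<close>.\<close>
fun canonical_perm_from :: "nat \<Rightarrow> nat list \<Rightarrow> nat \<Rightarrow> nat" where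
  "canonical_perm_from s [] = id"
| "canonical_perm_from s (z # \<zeta>) =
    cycle_of_list [s + 1..<s + z + 1] \<circ> canonical_perm_from (s + z) \<zeta>"

definition canonical_perm :: "nat list \<Rightarrow> nat \<Rightarrow> nat" where
  "canonical_perm \<zeta> = canonical_perm_from 0 \<zeta>"

definition S_NC :: "nat \<Rightarrow> nat list \<Rightarrow> (nat \<Rightarrow> nat) set" where
  "S_NC g \<zeta> = {\<alpha>. \<alpha> permutes {1..sum_list \<zeta>} \<and>
      transitive_pair (sum_list \<zeta>) \<alpha> (canonical_perm \<zeta>) \<and>
      has_genus (sum_list \<zeta>) (canonical_perm \<zeta>) \<alpha> g}"

definition s_coeff ::
  "(nat \<Rightarrow> complex) \<Rightarrow> (nat \<Rightarrow> complex) \<Rightarrow> nat \<Rightarrow> nat \<Rightarrow> nat \<Rightarrow> complex" where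
  "s_coeff u v n k g =
    (\<Sum>\<zeta> \<in> {\<zeta> \<in> int_partitions n. int (length \<zeta>) = int k + 1 - 2 * int g}.
       of_nat n / (of_nat (\<Prod>i<length \<zeta>. \<zeta> ! i) * (\<Prod>i=1..n. fact (count_list \<zeta> i)))
       * (\<Sum>\<alpha> \<in> S_NC g \<zeta>.
            block_prod u (cycle_partition n \<alpha>) *
            block_prod v (cycle_partition n (inv_into UNIV \<alpha> \<circ> canonical_perm \<zeta>))))"

end

theory Submission
  imports Defs
begin

text \<open>
  The value \<open>\<mu>(0\<^sub>n, \<sigma>)\<close> is the signed number of permutations with cycle partition \<open>\<sigma>\<close>: the
  permutations whose cycle partition refines a given \<open>\<sigma> \<noteq> 0\<^sub>n\<close> are paired off, with opposite signs,
  by multiplication with a transposition inside a block of \<open>\<sigma>\<close>. This turns the left-hand side into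
  a sum over pairs \<open>(\<alpha>, \<beta>)\<close> of permutations that generate a transitive group, because the join of
  two cycle partitions is the partition into the orbits of the generated group. Put \<open>\<gamma> = \<alpha>\<beta>\<close>. For
  fixed \<open>\<gamma>\<close> the sum over \<open>\<alpha>\<close> depends only on the cycle type \<open>\<zeta>\<close> of \<open>\<gamma>\<close>, and the class of \<open>\<zeta>\<close> has
  \<open>n! / (\<Prod> \<zeta>\<^sub>i \<Prod> t\<^sub>i!)\<close> elements. The number of cycles of \<open>\<alpha>\<close> and \<open>\<beta>\<close> together being \<open>n + 1 - k\<close>, the
  genus equation says \<open>\<ell>(\<zeta>) = k + 1 - 2g\<close>. That \<open>g\<close> is a natural number follows from the parity of
  permutations and from the Euler inequality
  \<open>#(\<alpha>) + #(\<beta>) + #(\<alpha>\<beta>) \<le> n + 2c\<close>, where \<open>c\<close> is the number of orbits of the generated group; it is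
  proved by splitting fixed points off \<open>\<alpha>\<close> one at a time.
\<close>

section \<open>Connected components of relations\<close>

text \<open>Classes are taken in the whole type and lie inside \<open>A\<close> only if
  \<open>r\<close> does not leave \<open>A\<close>. Components replace group orbits: the orbits of a
  generated group are the components of the union of the arrows of its generators.\<close>

definition comps :: "'a set \<Rightarrow> ('a \<Rightarrow> 'a \<Rightarrow> bool) \<Rightarrow> 'a set set" where
  "comps A r = (\<lambda>x. Collect (equivclp r x)) ` A"

definition arrow :: "('a \<Rightarrow> 'a) \<Rightarrow> 'a \<Rightarrow> 'a \<Rightarrow> bool" where
  "arrow f x y \<longleftrightarrow> y = f x"

definition edge :: "'a \<Rightarrow> 'a \<Rightarrow> 'a \<Rightarrow> 'a \<Rightarrow> bool" where
  "edge a b x y \<longleftrightarrow> x = a \<and> y = b"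

definition cycles :: "'a set \<Rightarrow> ('a \<Rightarrow> 'a) \<Rightarrow> 'a set set" where
  "cycles A f = Orbits.orbit f ` A"

lemma equivclp_least:
  assumes "\<And>x y. r x y \<Longrightarrow> equivclp s x y" and "equivclp r x y"
  shows "equivclp s x y"
  using assms(2)
proof (induction rule: equivclp_induct)
  case (step y z)
  then show ?case by (meson assms(1) equivclp_sym equivclp_trans)
qed simp

lemma equivclp_eqI:
  assumes "\<And>x y. r x y \<Longrightarrow> equivclp s x y" and "\<And>x y. s x y \<Longrightarrow> equivclp r x y"
  shows "equivclp r = equivclp s"
  using equivclp_least[of r s] equivclp_least[of s r] assms by (intro ext) blast

lemma equivclp_supI1: "equivclp r x y \<Longrightarrow> equivclp (sup r s) x y"
  by (erule equivclp_least[rotated]) auto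

text \<open>A path that uses the new edge can be shortened so that it crosses it only once, in one
  of the two directions.\<close>

lemma equivclp_sup_edge_iff:
  "equivclp (sup r (edge a b)) x y \<longleftrightarrow> equivclp r x y \<or>
    equivclp r x a \<and> equivclp r b y \<or> equivclp r x b \<and> equivclp r a y" (is "_ = ?R x y")
proof
  assume "equivclp (sup r (edge a b)) x y"
  then show "?R x y"
  proof (induction rule: equivclp_induct)
    case (step y z)
    have "?R x z" if "?R x y" "r y z \<or> r z y"
      using that by (blast intro: equivclp_into_equivclp)
    moreover have "?R x z" if "?R x y" "edge a b y z \<or> edge a b z y"
      using that unfolding edge_def by (auto intro: equivclp_sym)
    ultimately show ?case using step by auto
  qed simp
next
  have "equivclp (sup r (edge a b)) a b" by (rule r_into_equivclp) (simp add: edge_def)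
  then have "equivclp (sup r (edge a b)) a b" "equivclp (sup r (edge a b)) b a"
    by (auto intro: equivclp_sym)
  moreover assume "?R x y"
  ultimately show "equivclp (sup r (edge a b)) x y"
    by (meson equivclp_supI1 equivclp_trans)
qed

lemma equivclp_class_eq_iff:
  "Collect (equivclp r x) = Collect (equivclp r y) \<longleftrightarrow> equivclp r x y"
  by (metis equivclp_refl equivclp_sym equivclp_trans mem_Collect_eq subsetI subset_antisym)

lemma equivclp_sup_edge_absorb:
  assumes "equivclp r a b"
  shows "equivclp (sup r (edge a b)) = equivclp r"
  using assms by (intro equivclp_eqI) (auto simp: edge_def)

lemma comps_cong: "equivclp r = equivclp s \<Longrightarrow> comps A r = comps A s"
  by (simp add: comps_def)

text \<open>The new edge merges the classes of \<open>a\<close> and \<open>b\<close> into one and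
  leaves every other class as it was.\<close>

lemma card_comps_sup_edge:
  assumes "finite A" "a \<in> A" "b \<in> A" "\<not> equivclp r a b"
  shows "card (comps A r) = card (comps A (sup r (edge a b))) + 1"
proof -
  let ?C = "\<lambda>x. Collect (equivclp r x)" and ?r' = "sup r (edge a b)"
  \<comment> \<open>\<open>B\<close> collects the points outside the two classes that merge.\<close>
  define B where "B = {x \<in> A. \<not> equivclp r a x \<and> \<not> equivclp r b x}"
  have same: "Collect (equivclp ?r' x) = ?C x" if "x \<in> B" for x
    using that unfolding B_def equivclp_sup_edge_iff by (auto dest: equivclp_sym)
  have merged: "Collect (equivclp ?r' x) = ?C a \<union> ?C b" if "x \<in> A - B" for x
    using that unfolding B_def equivclp_sup_edge_iff
    by (auto dest: equivclp_sym intro: equivclp_trans)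
  have "a \<in> A - B" using assms by (simp add: B_def)
  have "comps A ?r' = (\<lambda>x. Collect (equivclp ?r' x)) ` B \<union> (\<lambda>x. Collect (equivclp ?r' x)) ` (A - B)"
    unfolding comps_def image_Un[symmetric] by (rule arg_cong[of _ _ "image _"]) (auto simp: B_def)
  also have "(\<lambda>x. Collect (equivclp ?r' x)) ` B = ?C ` B"
    using same by (intro image_cong) auto
  also have "(\<lambda>x. Collect (equivclp ?r' x)) ` (A - B) = {?C a \<union> ?C b}"
    using merged \<open>a \<in> A - B\<close> by blast
  finally have new: "comps A ?r' = insert (?C a \<union> ?C b) (?C ` B)" by (simp only: Un_insert_right Un_empty_right)
  have "?C x \<in> {?C a, ?C b}" if "x \<in> A - B" for x
    using that by (auto simp: B_def equivclp_class_eq_iff dest: equivclp_sym)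
  then have old: "comps A r = insert (?C a) (insert (?C b) (?C ` B))"
    using assms(2,3) unfolding comps_def by (auto simp: B_def)
  have fin: "finite (?C ` B)" using assms by (simp add: B_def)
  have ne: "?C a \<noteq> ?C b" using assms by (simp add: equivclp_class_eq_iff)
  have notin: "?C a \<notin> ?C ` B" "?C b \<notin> ?C ` B"
    by (auto simp: B_def equivclp_class_eq_iff image_iff)
  have Un: "?C a \<union> ?C b \<notin> ?C ` B"
  proof
    assume "?C a \<union> ?C b \<in> ?C ` B"
    then obtain x where "x \<in> B" and x: "?C a \<union> ?C b = ?C x" by auto
    have "a \<in> ?C a \<union> ?C b" by simp
    then have "equivclp r x a" unfolding x by simp
    with \<open>x \<in> B\<close> show False by (auto simp: B_def dest: equivclp_sym)
  qed
  have card: "card (insert X (insert Y S)) = card (insert Z S) + 1"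
    if "X \<noteq> Y" "X \<notin> S" "Y \<notin> S" "Z \<notin> S" "finite S" for X Y Z :: "'a set" and S
    using that by simp
  show ?thesis unfolding new old by (rule card[OF ne notin Un fin])
qed

section \<open>Cycles of permutations\<close>

text \<open>Orbits only go forward along \<open>f\<close>, while the closure also goes backward. On
  a finite cycle a backward step is a sequence of forward steps.\<close>

lemma orbit_eq_equivclp:
  assumes "permutation f"
  shows "Orbits.orbit f x = Collect (equivclp (arrow f) x)"
proof (intro equalityI subsetI)
  fix y assume "y \<in> Orbits.orbit f x"
  then have "equivclp (arrow f) x y"
    by induction (auto simp: arrow_def intro: equivclp_into_equivclp)
  then show "y \<in> Collect (equivclp (arrow f) x)" by simp
next
  fix y assume "y \<in> Collect (equivclp (arrow f) x)"
  then have "equivclp (arrow f) x y" by simp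
  then show "y \<in> Orbits.orbit f x"
  proof (induction rule: equivclp_induct)
    case base
    show ?case using assms by (rule permutation_self_in_orbit)
  next
    case (step y z)
    then consider "z = f y" | "y = f z" by (auto simp: arrow_def)
    then show ?case
    proof cases
      case 1 with step show ?thesis by (auto intro: Orbits.orbit.step)
    next
      case 2
      then have "Orbits.orbit f y = Orbits.orbit f z"
        using permutation_orbit_step[OF assms] by simp
      then have "z \<in> Orbits.orbit f y" using permutation_self_in_orbit[OF assms] by simp
      with step show ?thesis by (blast intro: orbit_trans)
    qed
  qed
qed

lemma cycles_eq_comps: "permutation f \<Longrightarrow> cycles A f = comps A (arrow f)"
  by (simp add: cycles_def comps_def orbit_eq_equivclp)

lemma cycles_id: "cycles A id = (\<lambda>x. {x}) ` A"
  unfolding cycles_def by (intro image_cong refl) (simp add: orbit_eq_singleton_iff)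

text \<open>
  Identifying \<open>a\<close> and \<open>b\<close> makes \<open>f\<close> and \<open>(a b) \<circ> f\<close> indistinguishable. Hence all statements about
  the effect of a transposition on cycles and orbits reduce to adding a single edge.
\<close>
lemma equivclp_arrow_transpose:
  "equivclp (sup (sup (arrow (transpose a b \<circ> f)) r) (edge a b)) = equivclp (sup (sup (arrow f) r) (edge a b))"
proof -
  \<comment> \<open>The transposition moves a target only between \<open>a\<close> and
    \<open>b\<close>, which the extra edge connects anyway.\<close>
  have 1: "equivclp (sup (sup s r) (edge a b)) x (transpose a b y)"
    if "s x y" for s :: "'a \<Rightarrow> 'a \<Rightarrow> bool" and x y
  proof -
    have "equivclp (sup (sup s r) (edge a b)) x y" using that by auto
    moreover have "equivclp (sup (sup s r) (edge a b)) a b"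
      by (rule r_into_equivclp) (simp add: edge_def)
    ultimately show ?thesis unfolding transpose_def
      by (auto intro: equivclp_trans equivclp_sym)
  qed
  show ?thesis
  proof (rule equivclp_eqI)
    fix x y assume "sup (sup (arrow (transpose a b \<circ> f)) r) (edge a b) x y"
    then show "equivclp (sup (sup (arrow f) r) (edge a b)) x y"
      using 1[of "arrow f" x "f x"] by (auto simp: arrow_def)
  next
    fix x y assume "sup (sup (arrow f) r) (edge a b) x y"
    then show "equivclp (sup (sup (arrow (transpose a b \<circ> f)) r) (edge a b)) x y"
      using 1[of "arrow (transpose a b \<circ> f)" x "transpose a b (f x)"] by (auto simp: arrow_def)
  qed
qed

lemma equivclp_arrow_transpose':
  "equivclp (sup (arrow (transpose a b \<circ> f)) (edge a b)) = equivclp (sup (arrow f) (edge a b))"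
  using equivclp_arrow_transpose[of a b f bot] by simp

section \<open>Transpositions, cycle numbers and signs\<close>

lemma permutation_transpose_comp: "permutation f \<Longrightarrow> permutation (transpose a b \<circ> f)"
  by (rule permutation_compose[OF permutation_swap_id])

text \<open>The composition makes \<open>a\<close> a fixed point, hence separate from
  \<open>f a\<close>; joining the two again gives back the cycles of \<open>f\<close>.\<close>

lemma card_cycles_split:
  assumes "f permutes A" "finite A" "f a \<noteq> a"
  shows "card (cycles A (transpose a (f a) \<circ> f)) = card (cycles A f) + 1"
proof -
  let ?g = "transpose a (f a) \<circ> f"
  have perm: "permutation f" using assms permutation_permutes by blast
  then have perm': "permutation ?g" by (rule permutation_transpose_comp)
  have A: "a \<in> A" "f a \<in> A" using assms by (metis permutes_def, metis permutes_def permutes_in_image)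
  have "Orbits.orbit ?g a = {a}" by (simp add: orbit_eq_singleton_iff)
  then have "\<not> equivclp (arrow ?g) a (f a)"
    using assms(3) orbit_eq_equivclp[OF perm', of a] by auto
  from card_comps_sup_edge[OF assms(2) A this]
  have "card (cycles A ?g) = card (comps A (sup (arrow ?g) (edge a (f a)))) + 1"
    by (simp add: cycles_eq_comps[OF perm'])
  \<comment> \<open>Once the transposition is dropped, the added edge is itself an arrow of
    \<open>f\<close> and changes nothing.\<close>
  also have "comps A (sup (arrow ?g) (edge a (f a))) = comps A (arrow f)"
    by (intro comps_cong, subst equivclp_arrow_transpose', subst equivclp_sup_edge_absorb)
      (auto simp: arrow_def)
  finally show ?thesis by (simp only: cycles_eq_comps[OF perm])
qed

text \<open>Each split turns one moved point into a fixed point, so finitely many splits lead to the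
  identity.\<close>

lemma permutes_split_induct [consumes 2, case_names id split]:
  assumes "f permutes A" "finite A"
    and id: "P id"
    and split: "\<And>f a. f permutes A \<Longrightarrow> a \<in> A \<Longrightarrow> f a \<noteq> a \<Longrightarrow> P (transpose a (f a) \<circ> f) \<Longrightarrow> P f"
  shows "P f"
proof -
  \<comment> \<open>\<open>S\<close> contains all moved points and loses one at every split, while
    the hypothesis \<open>split\<close> keeps referring to the fixed set \<open>A\<close>.\<close>
  have "P f" if "finite S" "f permutes S" "S \<subseteq> A" for S f
    using that
  proof (induction S arbitrary: f rule: finite_induct)
    case empty
    then show ?case using id by (simp only: permutes_empty)
  next
    case (insert a S)
    have "P (transpose a (f a) \<circ> f)"
      using insert.prems by (intro insert.IH permutes_insert_lemma) auto
    then show ?case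
      using split[of f a] insert.prems permutes_subset[OF insert.prems] by (cases "f a = a") auto
  qed
  then show ?thesis using assms by blast
qed

text \<open>Every split flips the sign and adds one cycle; for the identity the exponent is twice
  the number of points.\<close>

lemma sign_eq_card_cycles:
  assumes "f permutes A" "finite A"
  shows "sign f = (-1) ^ (card A + card (cycles A f))"
  using assms
proof (induction rule: permutes_split_induct)
  case id
  have "card (cycles A id) = card A" by (simp add: cycles_id card_image)
  then show ?case by (simp add: id_def)
next
  case (split f a)
  have "permutation f" using split assms(2) permutation_permutes by blast
  then have "sign (transpose a (f a) \<circ> f) = - sign f"
    using split by (simp add: sign_compose permutation_swap_id sign_swap_id)
  with split.IH show ?case
    using card_cycles_split[OF split(1) assms(2) split(3)] by (simp add: comp_def)
qed

text \<open>Equal cycle numbers would force equal signs, but a transposition flips the sign.\<close>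

lemma card_cycles_transpose_neq:
  assumes "f permutes A" "finite A" "a \<in> A" "b \<in> A" "a \<noteq> b"
  shows "card (cycles A (transpose a b \<circ> f)) \<noteq> card (cycles A f)"
proof
  have perm: "permutation f" using assms permutation_permutes by blast
  have "transpose a b \<circ> f permutes A"
    using assms by (intro permutes_compose permutes_swap_id)
  moreover assume "card (cycles A (transpose a b \<circ> f)) = card (cycles A f)"
  ultimately have "sign (transpose a b \<circ> f) = sign f"
    using assms by (simp add: sign_eq_card_cycles)
  then show False
    using assms perm by (simp add: sign_compose permutation_swap_id sign_swap_id)
qed

text \<open>With \<open>a\<close> and \<open>b\<close> identified, both permutations have the same
  number \<open>?m\<close> of components. Each cycle number is therefore \<open>?m\<close> or
  \<open>?m + 1\<close>, and by parity the two differ.\<close>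

lemma card_cycles_transpose_cases:
  assumes "f permutes A" "finite A" "a \<in> A" "b \<in> A" "a \<noteq> b"
  shows "card (cycles A (transpose a b \<circ> f)) =
    (if equivclp (arrow f) a b then card (cycles A f) + 1 else card (cycles A f) - 1)"
proof -
  let ?g = "transpose a b \<circ> f"
  have perm: "permutation f" using assms permutation_permutes by blast
  then have perm': "permutation ?g" by (rule permutation_transpose_comp)
  let ?m = "card (comps A (sup (arrow f) (edge a b)))"
  have "comps A (sup (arrow ?g) (edge a b)) = comps A (sup (arrow f) (edge a b))"
    by (intro comps_cong equivclp_arrow_transpose')
  then have g: "card (cycles A ?g) \<in> {?m, ?m + 1}"
    using card_comps_sup_edge[OF assms(2-4), of "arrow ?g"] equivclp_sup_edge_absorb[of "arrow ?g" a b]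
    by (cases "equivclp (arrow ?g) a b") (auto simp: cycles_eq_comps[OF perm'] comps_def)
  have f: "card (cycles A f) = (if equivclp (arrow f) a b then ?m else ?m + 1)"
    using card_comps_sup_edge[OF assms(2-4), of "arrow f"] equivclp_sup_edge_absorb[of "arrow f" a b]
    by (auto simp: cycles_eq_comps[OF perm] comps_def)
  show ?thesis using f g card_cycles_transpose_neq[OF assms] by auto
qed

section \<open>The genus is a natural number\<close>

text \<open>Undoing a split of \<open>f\<close> lowers its cycle number by one and changes that of
  the product by one. If \<open>a\<close> and \<open>f a\<close> were already in one orbit, the
  right-hand side is unchanged and the left one does not grow. Otherwise two orbits merge, the
  right-hand side drops by two, and the product loses a cycle as well.\<close>

lemma euler_inequality:
  assumes "f permutes A" "h permutes A" "finite A"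
  shows "card (cycles A f) + card (cycles A h) + card (cycles A (f \<circ> h))
    \<le> card A + 2 * card (comps A (sup (arrow f) (arrow h)))"
  using assms(1,3)
proof (induction rule: permutes_split_induct)
  case id
  \<comment> \<open>Equality holds here: the identity has as many cycles as points, and both the
    product and the components are given by \<open>h\<close>.\<close>
  have "equivclp (sup (arrow id) (arrow h)) = equivclp (arrow h)"
    by (intro equivclp_eqI) (auto simp: arrow_def)
  moreover have "permutation h" using assms permutation_permutes by blast
  ultimately have "comps A (sup (arrow id) (arrow h)) = cycles A h"
    by (simp only: cycles_eq_comps comps_def)
  then show ?case by (simp add: cycles_id[unfolded id_def] card_image id_def sup_fun_def)
next
  case (split f a)
  let ?b = "f a" let ?g = "transpose a ?b \<circ> f"
  let ?r = "sup (arrow ?g) (arrow h)"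
  have [simp]: "transpose a ?b \<circ> ?g = f" by (simp add: o_assoc)
  have ab: "a \<in> A" "?b \<in> A" "a \<noteq> ?b" using split by (auto simp: permutes_in_image)
  have g: "?g permutes A" using split ab by (intro permutes_compose permutes_swap_id)
  then have gh: "?g \<circ> h permutes A" using assms(2) by (rule permutes_compose[rotated])
  then have perm: "permutation (?g \<circ> h)" using assms permutation_permutes by blast
  have fh: "transpose a ?b \<circ> (?g \<circ> h) = f \<circ> h"
    by (metis \<open>transpose a ?b \<circ> ?g = f\<close> o_assoc)
  have cf: "card (cycles A ?g) = card (cycles A f) + 1"
    using split assms by (intro card_cycles_split)
  \<comment> \<open>The edge from \<open>a\<close> to \<open>f a\<close> is already an arrow of
    \<open>f\<close>; once it is written explicitly, \<open>f\<close> may be replaced by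
    \<open>?g\<close>.\<close>
  have "equivclp (sup (arrow f) (arrow h)) = equivclp (sup (sup (arrow f) (arrow h)) (edge a ?b))"
    by (intro equivclp_sup_edge_absorb[symmetric] equivclp_supI1) (auto simp: arrow_def)
  then have c: "comps A (sup (arrow f) (arrow h)) = comps A (sup ?r (edge a ?b))"
    by (intro comps_cong) (simp add: equivclp_arrow_transpose)
  have cfh: "card (cycles A (f \<circ> h)) =
    (if equivclp (arrow (?g \<circ> h)) a ?b then card (cycles A (?g \<circ> h)) + 1 else card (cycles A (?g \<circ> h)) - 1)"
    using card_cycles_transpose_cases[OF gh assms(3) ab] by (simp only: fh)
  have IH: "card (cycles A ?g) + card (cycles A h) + card (cycles A (?g \<circ> h))
      \<le> card A + 2 * card (comps A ?r)"
    using split.IH unfolding comp_def .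
  have "card (cycles A f) + card (cycles A h) + card (cycles A (f \<circ> h))
      \<le> card A + 2 * card (comps A (sup (arrow f) (arrow h)))"
  proof (cases "equivclp ?r a ?b")
    case True
    then have "comps A (sup (arrow f) (arrow h)) = comps A ?r"
      unfolding c by (intro comps_cong equivclp_sup_edge_absorb)
    then show ?thesis using IH cf cfh by (auto split: if_splits)
  next
    case False
    then have "card (comps A ?r) = card (comps A (sup (arrow f) (arrow h))) + 1"
      unfolding c using ab assms by (intro card_comps_sup_edge)
    \<comment> \<open>A step of the product is a step of \<open>h\<close> followed by one of
      \<open>?g\<close>, so its cycles stay inside the components.\<close>
    moreover have "\<not> equivclp (arrow (?g \<circ> h)) a ?b"
    proof
      assume "equivclp (arrow (?g \<circ> h)) a ?b"
      then have "equivclp ?r a ?b"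
      proof (rule equivclp_least[rotated])
        fix x y assume "arrow (?g \<circ> h) x y"
        then have "?r x (h x)" "?r (h x) y" by (auto simp: arrow_def)
        then show "equivclp ?r x y" by (blast intro: equivclp_trans)
      qed
      with False show False by simp
    qed
    \<comment> \<open>The decrease in \<open>cfh\<close> is a subtraction of natural numbers, so
      positivity of the cycle number is required.\<close>
    moreover have "cycles A (?g \<circ> h) \<noteq> {}" using ab by (auto simp: cycles_def)
    then have "card (cycles A (?g \<circ> h)) > 0"
      using assms by (simp add: cycles_def card_gt_0_iff)
    ultimately show ?thesis using IH cf cfh by auto
  qed
  then show ?case unfolding comp_def .
qed

text \<open>Multiplicativity of the sign, read off in the exponents of -1.\<close>

lemma even_euler_characteristic:
  assumes "f permutes A" "h permutes A" "finite A"
  shows "even (card A + card (cycles A f) + card (cycles A h) + card (cycles A (f \<circ> h)))"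
proof -
  have "permutation f" "permutation h" using assms permutation_permutes by blast+
  then have "sign (f \<circ> h) = sign f * sign h" by (rule sign_compose)
  moreover have "f \<circ> h permutes A" using assms by (intro permutes_compose)
  ultimately have "(-1::int) ^ (card A + card (cycles A (f \<circ> h))) =
    (-1) ^ (card A + card (cycles A f)) * (-1) ^ (card A + card (cycles A h))"
    using assms by (simp add: sign_eq_card_cycles)
  then show ?thesis
    by (cases "even (card A)"; cases "even (card (cycles A f))"; cases "even (card (cycles A h))";
        cases "even (card (cycles A (f \<circ> h)))") (simp_all add: minus_one_power_iff)
qed

section \<open>Partitions into connected components\<close>

lemma equivclp_closed:
  assumes "\<And>x y. r x y \<Longrightarrow> x \<in> A \<longleftrightarrow> y \<in> A" and "equivclp r x y"
  shows "x \<in> A \<longleftrightarrow> y \<in> A"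
  using assms(2) by (induction rule: equivclp_induct) (use assms(1) in blast)+

lemma partition_on_comps:
  assumes "\<And>x y. r x y \<Longrightarrow> x \<in> A \<longleftrightarrow> y \<in> A"
  shows "partition_on A (comps A r)"
proof (rule partition_onI)
  show "\<Union> (comps A r) = A"
  proof (intro equalityI subsetI)
    fix y assume "y \<in> \<Union> (comps A r)"
    then obtain x where "x \<in> A" "equivclp r x y" by (auto simp: comps_def)
    then show "y \<in> A" using equivclp_closed[of r A, OF assms] by blast
  next
    fix y assume "y \<in> A"
    then have "Collect (equivclp r y) \<in> comps A r" by (simp add: comps_def)
    then show "y \<in> \<Union> (comps A r)" using equivclp_refl[of r y] by blast
  qed
  show "{} \<notin> comps A r" by (auto simp: comps_def intro: equivclp_refl)
next
  fix p q assume "p \<in> comps A r" "q \<in> comps A r" "p \<noteq> q"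
  then obtain x y where "p = Collect (equivclp r x)" "q = Collect (equivclp r y)"
    by (auto simp: comps_def)
  moreover from this have "\<not> equivclp r x y"
    using \<open>p \<noteq> q\<close> equivclp_class_eq_iff[of r x y] by blast
  ultimately show "disjnt p q" unfolding disjnt_iff by (metis equivclp_sym equivclp_trans mem_Collect_eq)
qed

text \<open>Blocks are disjoint, so a block that contains the start of a path keeps it step by step.
  Testing single steps is what makes the universal property of the join visible.\<close>

lemma refines_comps_iff:
  assumes "\<And>x y. r x y \<Longrightarrow> x \<in> A \<longleftrightarrow> y \<in> A" and Q: "partition_on A Q"
  shows "refines A (comps A r) Q \<longleftrightarrow> (\<forall>x\<in>A. \<forall>y. r x y \<longrightarrow> (\<exists>B\<in>Q. x \<in> B \<and> y \<in> B))"
proof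
  assume ref: "refines A (comps A r) Q"
  show "\<forall>x\<in>A. \<forall>y. r x y \<longrightarrow> (\<exists>B\<in>Q. x \<in> B \<and> y \<in> B)"
  proof (intro ballI allI impI)
    fix x y assume "x \<in> A" "r x y"
    then obtain B where "B \<in> Q" "Collect (equivclp r x) \<subseteq> B"
      using ref by (auto simp: refines_def comps_def)
    with \<open>r x y\<close> show "\<exists>B\<in>Q. x \<in> B \<and> y \<in> B" by (intro bexI[of _ B]) auto
  qed
next
  assume step: "\<forall>x\<in>A. \<forall>y. r x y \<longrightarrow> (\<exists>B\<in>Q. x \<in> B \<and> y \<in> B)"
  have unique: "B = C" if "B \<in> Q" "C \<in> Q" "x \<in> B" "x \<in> C" for x B C
    using Q that by (auto simp: partition_on_def disjoint_def)
  have "y \<in> B" if "B \<in> Q" "x \<in> B" "equivclp r x y" for x y B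
    using that(3,2)
  proof (induction rule: equivclp_induct)
    case (step y z)
    then have "y \<in> A" using Q that by (auto simp: partition_on_def)
    then have "z \<in> A" using assms(1) step.hyps by blast
    with \<open>y \<in> A\<close> step.hyps \<open>\<forall>x\<in>A. _ x\<close> obtain C where "C \<in> Q" "y \<in> C" "z \<in> C" by blast
    with step that unique[of B C y] show ?case by auto
  qed
  then have "\<exists>B\<in>Q. Collect (equivclp r x) \<subseteq> B" if "x \<in> A" for x
    using that Q unfolding partition_on_def by blast
  then show "refines A (comps A r) Q"
    using Q partition_on_comps[of r A, OF assms(1)] by (auto simp: refines_def comps_def)
qed

lemma comps_eq_singleton_iff:
  assumes "\<And>x y. r x y \<Longrightarrow> x \<in> A \<longleftrightarrow> y \<in> A" and "A \<noteq> {}"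
  shows "comps A r = {A} \<longleftrightarrow> (\<forall>x\<in>A. \<forall>y\<in>A. equivclp r x y)"
proof
  assume eq: "comps A r = {A}"
  show "\<forall>x\<in>A. \<forall>y\<in>A. equivclp r x y"
  proof (intro ballI)
    fix x y assume "x \<in> A" "y \<in> A"
    then have "Collect (equivclp r x) \<in> comps A r" by (simp add: comps_def)
    then have "Collect (equivclp r x) = A" using eq by simp
    with \<open>y \<in> A\<close> show "equivclp r x y" by blast
  qed
next
  assume "\<forall>x\<in>A. \<forall>y\<in>A. equivclp r x y"
  then have "Collect (equivclp r x) = A" if "x \<in> A" for x
    using equivclp_closed[of r A, OF assms(1)] that by blast
  then show "comps A r = {A}" using assms(2) unfolding comps_def by auto
qed

section \<open>Cycle partitions and the lattice operations\<close>

lemma arrow_closed: "f permutes A \<Longrightarrow> arrow f x y \<Longrightarrow> x \<in> A \<longleftrightarrow> y \<in> A"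
  by (simp add: arrow_def permutes_in_image)

lemma partition_on_cycles:
  assumes "f permutes A" "finite A"
  shows "partition_on A (cycles A f)"
  using partition_on_comps[of "arrow f" A] assms cycles_eq_comps[of f A] permutation_permutes[of f]
  by (metis arrow_closed)

lemma refines_cycles_iff:
  assumes "f permutes A" "finite A" "partition_on A Q"
  shows "refines A (cycles A f) Q \<longleftrightarrow> (\<forall>x\<in>A. \<exists>B\<in>Q. x \<in> B \<and> f x \<in> B)"
proof -
  have "cycles A f = comps A (arrow f)"
    using assms permutation_permutes by (intro cycles_eq_comps) blast
  then show ?thesis
    using refines_comps_iff[of "arrow f" A, OF arrow_closed[OF assms(1)] assms(3)] by (simp add: arrow_def)
qed

lemma cycles_id_refines:
  fixes n :: nat
  assumes "partition_on {1..n} Q"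
  shows "refines {1..n} (cycles {1..n} id) Q"
  unfolding refines_cycles_iff[OF permutes_id finite_atLeastAtMost assms]
  using partition_onD1[OF assms] by auto

lemma carrier_set_partitions: "p \<in> carrier (set_partitions n) \<longleftrightarrow> partition_on {1..n} p"
  by (simp add: set_partitions_def)

lemma le_set_partitions: "p \<sqsubseteq>\<^bsub>set_partitions n\<^esub> q \<longleftrightarrow> refines {1..n} p q"
  by (simp add: set_partitions_def)

lemma lless_set_partitions: "p \<sqsubset>\<^bsub>set_partitions n\<^esub> q \<longleftrightarrow> refines {1..n} p q \<and> p \<noteq> q"
  by (simp add: lless_def set_partitions_def)

text \<open>The partition into singletons is written as the cycle partition of the identity, so that
  the refinement criterion for cycles applies to it.\<close>

lemma bottom_set_partitions: "\<bottom>\<^bsub>set_partitions n\<^esub> = cycles {1..n} id"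
proof -
  have "least (set_partitions n) (cycles {1..n} id) (carrier (set_partitions n))"
    unfolding least_def
    using cycles_id_refines partition_on_cycles[OF permutes_id finite_atLeastAtMost]
    by (auto simp: carrier_set_partitions le_set_partitions simp del: One_nat_def)
  then show ?thesis
    unfolding bottom_def
    by (metis partial_order.least_unique partial_order_set_partitions someI_ex)
qed

lemma top_set_partitions:
  assumes "n \<ge> 1"
  shows "\<top>\<^bsub>set_partitions n\<^esub> = {{1..n}}"
proof -
  have "greatest (set_partitions n) {{1..n}} (carrier (set_partitions n))"
  proof -
    have "refines {1..n} Q {{1..n}}" if "partition_on {1..n} Q" for Q
      using that partition_onD1[OF that] assms by (auto simp: refines_def intro: partition_on_space)
    then show ?thesis
      using partition_on_space[of "{1..n}"] assms
      by (auto simp: greatest_def carrier_set_partitions le_set_partitions simp del: One_nat_def)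
  qed
  then show ?thesis
    unfolding top_def
    by (metis partial_order.greatest_unique partial_order_set_partitions someI_ex)
qed

text \<open>The arrows of the union are those of \<open>f\<close> and those of \<open>h\<close>. By
  the criterion on single steps, its components refine \<open>Q\<close> exactly when both cycle
  partitions do, which characterizes the least upper bound.\<close>

lemma join_cycles:
  assumes f: "f permutes {1..n}" and h: "h permutes {1..n}"
  shows "cycles {1..n} f \<squnion>\<^bsub>set_partitions n\<^esub> cycles {1..n} h = comps {1..n} (sup (arrow f) (arrow h))"
proof -
  let ?A = "{1..n}" and ?r = "sup (arrow f) (arrow h)" and ?L = "set_partitions n"
  have closed: "x \<in> ?A \<longleftrightarrow> y \<in> ?A" if "?r x y" for x y
    using that arrow_closed[OF f, of x y] arrow_closed[OF h, of x y] by auto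
  have steps: "(\<forall>x\<in>?A. \<forall>y. ?r x y \<longrightarrow> P x y) \<longleftrightarrow> (\<forall>x\<in>?A. P x (f x)) \<and> (\<forall>x\<in>?A. P x (h x))" for P
    by (auto simp: arrow_def)
  have iff: "refines ?A (comps ?A ?r) Q \<longleftrightarrow> refines ?A (cycles ?A f) Q \<and> refines ?A (cycles ?A h) Q"
    if "partition_on ?A Q" for Q
  proof -
    have "refines ?A (comps ?A ?r) Q \<longleftrightarrow> (\<forall>x\<in>?A. \<forall>y. ?r x y \<longrightarrow> (\<exists>B\<in>Q. x \<in> B \<and> y \<in> B))"
      by (rule refines_comps_iff[OF closed that])
    then show ?thesis
      unfolding steps refines_cycles_iff[OF f finite_atLeastAtMost that]
        refines_cycles_iff[OF h finite_atLeastAtMost that] .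
  qed
  have part: "partition_on ?A (comps ?A ?r)" by (rule partition_on_comps[of ?r, OF closed])
  have Upper: "Q \<in> Upper ?L {cycles ?A f, cycles ?A h} \<longleftrightarrow>
      partition_on ?A Q \<and> refines ?A (cycles ?A f) Q \<and> refines ?A (cycles ?A h) Q" for Q
    using partition_on_cycles[OF f] partition_on_cycles[OF h]
    by (auto simp: Upper_def carrier_set_partitions le_set_partitions)
  have "least ?L (comps ?A ?r) (Upper ?L {cycles ?A f, cycles ?A h})"
    unfolding least_def Ball_def Upper le_set_partitions
    using iff part refines_refl[OF part] Upper_closed[of ?L] by (simp only:) blast
  then show ?thesis
    unfolding join_def sup_def
    by (metis partial_order.least_unique partial_order_set_partitions someI_ex)
qed

section \<open>The Moebius function as a signed count of permutations\<close>

text \<open>Composition with the transposition of two points of one block is a sign-reversing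
  involution of the index set, so the sum equals its own negative.\<close>

lemma sum_sign_refining_cycles:
  assumes Q: "partition_on A Q" and "finite A" and B: "B \<in> Q" "a \<in> B" "b \<in> B" "a \<noteq> b"
  shows "(\<Sum>f | f permutes A \<and> refines A (cycles A f) Q. sign f) = 0"
proof -
  let ?S = "{f. f permutes A \<and> refines A (cycles A f) Q}" and ?t = "transpose a b"
  have ab: "a \<in> A" "b \<in> A" using Q B by (auto simp: partition_on_def)
  have t: "?t \<circ> f \<in> ?S" if "f \<in> ?S" for f
  proof -
    have f: "f permutes A" and ref: "\<forall>x\<in>A. \<exists>C\<in>Q. x \<in> C \<and> f x \<in> C"
      using that refines_cycles_iff[OF _ assms(2) Q] by auto
    have g: "?t \<circ> f permutes A" using f ab by (intro permutes_compose permutes_swap_id)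
    have "\<exists>C\<in>Q. x \<in> C \<and> ?t (f x) \<in> C" if "x \<in> A" for x
    proof -
      obtain C where C: "C \<in> Q" "x \<in> C" "f x \<in> C" using bspec[OF ref \<open>x \<in> A\<close>] by blast
      \<comment> \<open>If \<open>f x\<close> is moved by the transposition, its block is the one
        containing both \<open>a\<close> and \<open>b\<close>.\<close>
      have "C = B" if "f x \<in> {a, b}"
        using that C B Q by (auto simp: partition_on_def disjoint_def)
      then have "?t (f x) \<in> C" using C B by (auto simp: transpose_def)
      with C show ?thesis by blast
    qed
    then show ?thesis using g refines_cycles_iff[OF g assms(2) Q] by auto
  qed
  have sign: "sign (?t \<circ> f) = - sign f" if "f \<in> ?S" for f
  proof -
    have "permutation f" using that assms(2) permutation_permutes by blast
    then show ?thesis using B by (simp add: sign_compose permutation_swap_id sign_swap_id)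
  qed
  have "(\<Sum>f\<in>?S. sign f) = (\<Sum>f\<in>?S. sign (?t \<circ> f))"
    by (rule sum.reindex_bij_witness[of _ "\<lambda>f. ?t \<circ> f" "\<lambda>f. ?t \<circ> f"])
      (use t in \<open>simp_all add: o_assoc del: mem_Collect_eq\<close>)
  also have "\<dots> = - (\<Sum>f\<in>?S. sign f)"
    unfolding sum_negf[symmetric] using sign by (intro sum.cong) auto
  finally show ?thesis by simp
qed

text \<open>The Moebius function is determined by the value 1 at the bottom and by vanishing sums
  over the intervals from the bottom to any other \<open>p\<close>. The signed counts have both
  properties.\<close>

lemma moebius_set_partitions:
  assumes "p \<in> carrier (set_partitions n)"
  shows "moebius (set_partitions n) \<bottom>\<^bsub>set_partitions n\<^esub> p =
    (\<Sum>f | f permutes {1..n} \<and> cycles {1..n} f = p. sign f)"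
proof -
  let ?A = "{1..n}" and ?L = "set_partitions n"
  define F where "F p = (\<Sum>f | f permutes ?A \<and> cycles ?A f = p. sign f)" for p
  have bot_le: "cycles ?A id \<sqsubseteq>\<^bsub>?L\<^esub> q" if "q \<in> carrier ?L" for q
    using that by (simp add: carrier_set_partitions le_set_partitions cycles_id_refines del: One_nat_def)
  \<comment> \<open>The induction follows the recursion of \<open>moebius\<close>; the equations
    allow its first two arguments to remain variables.\<close>
  have "L = ?L \<Longrightarrow> x = \<bottom>\<^bsub>?L\<^esub> \<Longrightarrow> p \<in> carrier L \<Longrightarrow> moebius L x p = F p" for L x
    using assms
  proof (induction L x p rule: moebius.induct)
    case (1 L x p)
    then have p: "partition_on ?A p" and x: "x = cycles ?A id"
      by (auto simp: carrier_set_partitions bottom_set_partitions)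
    have cond: "partial_order L \<and> finite (carrier L) \<and> x \<in> carrier L \<and> p \<in> carrier L \<and> x \<sqsubseteq>\<^bsub>L\<^esub> p"
    proof -
      have "x \<in> carrier ?L"
        unfolding x carrier_set_partitions by (intro partition_on_cycles permutes_id finite_atLeastAtMost)
      then show ?thesis
        using "1.prems" bot_le partial_order_set_partitions finite_set_partitions by (simp add: x)
    qed
    show ?case
    proof (cases "x = p")
      case True
      \<comment> \<open>Only the identity has all cycles of length 1, so the signed count at the
        bottom is a single term 1.\<close>
      have "f = id" if "cycles ?A f = cycles ?A id" "f permutes ?A" for f
      proof
        fix y
        show "f y = id y"
        proof (cases "y \<in> ?A")
          case True
          then have "Orbits.orbit f y \<in> cycles ?A f" by (simp add: cycles_def)
          then have "Orbits.orbit f y \<in> cycles ?A id" using that by simp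
          moreover have "f y \<in> Orbits.orbit f y" by (rule Orbits.orbit.base)
          moreover have "y \<in> Orbits.orbit f y"
            using that permutation_permutes by (intro permutation_self_in_orbit) blast
          ultimately show ?thesis by (auto simp: cycles_id)
        next
          case False
          with that show ?thesis by (simp add: permutes_not_in)
        qed
      qed
      then have "{f. f permutes ?A \<and> cycles ?A f = p} = {id}"
        using True x by (auto simp: permutes_id)
      then have "F p = 1" by (simp add: F_def)
      moreover have "moebius L x p = 1" using cond True by (subst moebius.simps) simp
      ultimately show ?thesis by simp
    next
      case False
      let ?below = "{z \<in> carrier L. x \<sqsubseteq>\<^bsub>L\<^esub> z \<and> z \<sqsubset>\<^bsub>L\<^esub> p}"
      \<comment> \<open>Above the bottom some block has two points, and their transposition makes
        the sign sum vanish.\<close>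
      have "\<exists>B\<in>p. \<exists>a\<in>B. \<exists>b\<in>B. a \<noteq> b"
      proof (rule ccontr)
        assume *: "\<not> ?thesis"
        have single: "B = {a}" if "B \<in> p" "a \<in> B" for a B using * that by blast
        have "p = (\<lambda>x. {x}) ` ?A"
        proof (intro equalityI subsetI)
          fix B assume "B \<in> p"
          moreover from this obtain a where "a \<in> B" using p by (metis partition_onD3 ex_in_conv)
          ultimately have "B = {a}" "a \<in> ?A" using single partition_onD1[OF p] by blast+
          then show "B \<in> (\<lambda>x. {x}) ` ?A" by simp
        next
          fix B assume "B \<in> (\<lambda>x. {x}) ` ?A"
          then obtain x where "B = {x}" "x \<in> \<Union> p" using partition_onD1[OF p] by auto
          moreover from this obtain C where "C \<in> p" "x \<in> C" by blast
          ultimately show "B \<in> p" using single[of C x] by simp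
        qed
        with False show False by (simp add: x cycles_id)
      qed
      then have zero: "(\<Sum>f | f permutes ?A \<and> refines ?A (cycles ?A f) p. sign f) = 0"
        using sum_sign_refining_cycles[OF p] by auto
      have below: "?below = {z. refines ?A z p} - {p}"
        using 1 bot_le by (auto simp: x lless_set_partitions carrier_set_partitions refines_def)
      have fin: "finite {z. refines ?A z p}"
        by (rule finite_subset[OF _ finite_set_partitions[of n]])
          (auto simp: refines_def carrier_set_partitions)
      \<comment> \<open>Grouping the permutations by their cycle partition turns the vanishing sign
        sum into the Moebius recursion for \<open>F\<close>.\<close>
      have "(\<Sum>z\<in>{z. refines ?A z p}. F z) =
        (\<Sum>z\<in>{z. refines ?A z p}.
          \<Sum>f\<in>{f \<in> {f. f permutes ?A \<and> refines ?A (cycles ?A f) p}. cycles ?A f = z}. sign f)"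
        unfolding F_def by (intro sum.cong refl) auto
      also have "\<dots> = (\<Sum>f | f permutes ?A \<and> refines ?A (cycles ?A f) p. sign f)"
        by (rule sum.group) (use fin in \<open>auto simp: finite_permutations\<close>)
      finally have "(\<Sum>z\<in>{z. refines ?A z p}. F z) = 0" using zero by simp
      moreover have "(\<Sum>z\<in>{z. refines ?A z p}. F z) = F p + (\<Sum>z\<in>?below. F z)"
        unfolding below using fin refines_refl[OF p] by (intro sum.remove) auto
      moreover have "(\<Sum>z\<in>?below. moebius L x z) = (\<Sum>z\<in>?below. F z)"
      proof (rule sum.cong[OF refl])
        fix z assume "z \<in> ?below"
        then show "moebius L x z = F z" using 1 cond False by auto
      qed
      ultimately show ?thesis using cond False by (simp add: moebius.simps[of L x p])
    qed
  qed
  then show ?thesis using assms by (simp add: F_def)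
qed

section \<open>Transitivity\<close>

text \<open>A word in the generators traces a path, and each step of a path is the action of a
  generator or of its inverse.\<close>

lemma transitive_pair_iff:
  assumes f: "f permutes {1..n}" and h: "h permutes {1..n}"
  shows "transitive_pair n f h \<longleftrightarrow> (\<forall>i\<in>{1..n}. \<forall>j\<in>{1..n}. equivclp (sup (arrow f) (arrow h)) i j)"
proof -
  let ?r = "sup (arrow f) (arrow h)" and ?G = "generate (sym_group n) {f, h}"
  have carrier: "{f, h} \<subseteq> carrier (sym_group n)" using f h by (simp add: sym_group_carrier)
  have perm: "\<phi> permutes {1..n}" if "\<phi> \<in> ?G" for \<phi>
    using group.generate_in_carrier[OF sym_group_is_group carrier that] by (simp add: sym_group_carrier)
  have path: "equivclp ?r i (\<phi> i)" if "\<phi> \<in> ?G" for \<phi> i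
    using that
  proof (induction arbitrary: i rule: generate.induct)
    case one
    show ?case by (simp add: sym_group_one)
  next
    case (incl \<phi>)
    then have "?r i (\<phi> i)" by (auto simp: arrow_def)
    then show ?case by (rule r_into_equivclp)
  next
    case (inv \<phi>)
    then have "\<phi> permutes {1..n}" using f h by auto
    moreover from this have "\<phi> (inv_into UNIV \<phi> i) = i" by (simp add: permutes_inverses)
    ultimately have "?r (inv_into UNIV \<phi> i) i" using inv by (auto simp: arrow_def)
    then have "equivclp ?r i (inv_into UNIV \<phi> i)" by (rule converse_r_into_equivclp)
    moreover have "inv\<^bsub>sym_group n\<^esub> \<phi> = inv_into UNIV \<phi>"
      using \<open>\<phi> permutes {1..n}\<close> by (simp add: sym_group_carrier)
    ultimately show ?case by (simp only:)
  next
    case (eng \<phi> \<psi>)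
    then show ?case by (simp add: sym_group_mult) (blast intro: equivclp_trans)
  qed
  have reach: "\<exists>\<phi>\<in>?G. \<phi> i = j" if "equivclp ?r i j" for i j
    using that
  proof (induction rule: equivclp_induct)
    case base
    show ?case using generate.one[of "sym_group n" "{f, h}"]
      by (intro bexI[of _ id]) (auto simp: sym_group_one)
  next
    case (step y z)
    then obtain \<phi> where \<phi>: "\<phi> \<in> ?G" "\<phi> i = y" by blast
    from step.hyps obtain \<psi> where \<psi>: "\<psi> \<in> {f, h}" "z = \<psi> y \<or> y = \<psi> z"
      by (auto simp: arrow_def)
    then have "\<psi> permutes {1..n}" using f h by auto
    then have inv: "inv\<^bsub>sym_group n\<^esub> \<psi> = inv_into UNIV \<psi>" and "inv_into UNIV \<psi> (\<psi> z) = z"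
      by (simp_all add: sym_group_carrier permutes_inverses)
    then have "\<exists>\<chi>\<in>?G. \<chi> y = z"
      using \<psi> generate.incl[OF \<psi>(1), of "sym_group n"] generate.inv[OF \<psi>(1), of "sym_group n"] by auto
    then obtain \<chi> where "\<chi> \<in> ?G" "\<chi> y = z" by blast
    then have "\<chi> \<otimes>\<^bsub>sym_group n\<^esub> \<phi> \<in> ?G"
      using \<phi> by (intro generate.eng)
    moreover have "(\<chi> \<otimes>\<^bsub>sym_group n\<^esub> \<phi>) i = z"
      using \<phi> \<open>\<chi> y = z\<close> by (simp add: sym_group_mult)
    ultimately show ?case by (intro bexI[of _ "\<chi> \<otimes>\<^bsub>sym_group n\<^esub> \<phi>"])
  qed
  have "(\<exists>\<phi>\<in>?G. \<phi> i = j) \<longleftrightarrow> equivclp ?r i j" for i j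
  proof
    assume "\<exists>\<phi>\<in>?G. \<phi> i = j"
    then obtain \<phi> where "\<phi> \<in> ?G" "j = \<phi> i" by auto
    with path[of \<phi> i] show "equivclp ?r i j" by (simp only:)
  qed (rule reach)
  then show ?thesis by (simp only: transitive_pair_def)
qed

text \<open>The join consists of the orbits of the generated group, so it is the top exactly when
  there is one orbit.\<close>

lemma transitive_pair_iff_join:
  assumes f: "f permutes {1..n}" and h: "h permutes {1..n}" and "n \<ge> 1"
  shows "transitive_pair n f h \<longleftrightarrow>
    cycles {1..n} f \<squnion>\<^bsub>set_partitions n\<^esub> cycles {1..n} h = \<top>\<^bsub>set_partitions n\<^esub>"
proof -
  let ?r = "sup (arrow f) (arrow h)"
  have "x \<in> {1..n} \<longleftrightarrow> y \<in> {1..n}" if "?r x y" for x y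
    using that arrow_closed[OF f, of x y] arrow_closed[OF h, of x y] by auto
  from comps_eq_singleton_iff[of ?r "{1..n}", OF this] show ?thesis
    unfolding transitive_pair_iff[OF f h] join_cycles[OF f h] top_set_partitions[OF assms(3)]
    using assms(3) by simp
qed

text \<open>The pairs \<open>f\<close>, \<open>f \<circ> h\<close> and \<open>f\<close>,
  \<open>h\<close> generate the same group. This allows \<gamma> to take the place of \<beta> as
  second generator.\<close>

lemma transitive_pair_comp:
  assumes f: "f permutes {1..n}" and h: "h permutes {1..n}"
  shows "transitive_pair n f (f \<circ> h) \<longleftrightarrow> transitive_pair n f h"
proof -
  have "equivclp (sup (arrow f) (arrow (f \<circ> h))) = equivclp (sup (arrow f) (arrow h))"
  proof (rule equivclp_eqI)
    fix x y assume *: "sup (arrow f) (arrow (f \<circ> h)) x y"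
    have "equivclp (sup (arrow f) (arrow h)) x (h x)"
      "equivclp (sup (arrow f) (arrow h)) z (f z)" for z
      by (auto simp: arrow_def)
    then show "equivclp (sup (arrow f) (arrow h)) x y"
      using * by (auto simp: arrow_def intro: equivclp_trans)
  next
    fix x y assume *: "sup (arrow f) (arrow h) x y"
    \<comment> \<open>From \<open>x\<close> the path to \<open>h x\<close> passes through
      \<open>f (h x)\<close> and returns along the arrow of \<open>f\<close>.\<close>
    have "equivclp (sup (arrow f) (arrow (f \<circ> h))) x (f (h x))"
      "equivclp (sup (arrow f) (arrow (f \<circ> h))) z (f z)"
      "equivclp (sup (arrow f) (arrow (f \<circ> h))) (f z) z" for z
      by (auto simp: arrow_def)
    then show "equivclp (sup (arrow f) (arrow (f \<circ> h))) x y"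
      using * by (auto simp: arrow_def intro: equivclp_trans)
  qed
  then show ?thesis
    using assms by (simp add: transitive_pair_iff permutes_compose)
qed

section \<open>Permutations of a given cycle type\<close>

definition cycle_type :: "'a set \<Rightarrow> ('a \<Rightarrow> 'a) \<Rightarrow> nat multiset" where
  "cycle_type A f = image_mset card (mset_set (cycles A f))"

text \<open>Cycle notation with the brackets left out: \<open>xs\<close> is the sequence of entries
  and the list of lengths says where the brackets belong.\<close>

fun perm_of_cut :: "nat list \<Rightarrow> 'a list \<Rightarrow> 'a \<Rightarrow> 'a" where
  "perm_of_cut [] xs = id"
| "perm_of_cut (z # \<zeta>) xs = cycle_of_list (take z xs) \<circ> perm_of_cut \<zeta> (drop z xs)"

text \<open>The order of the centralizer of a permutation with these cycle lengths. The successive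
  multiplicities of each part multiply to a factorial; this recursive form matches the counting of
  lists by their first cycle.\<close>

fun centralizer_size :: "nat list \<Rightarrow> nat" where
  "centralizer_size [] = 1"
| "centralizer_size (z # \<zeta>) = z * count_list (z # \<zeta>) z * centralizer_size \<zeta>"

lemma orbit_eq_of_mem:
  assumes "permutation f" "y \<in> Orbits.orbit f x"
  shows "Orbits.orbit f y = Orbits.orbit f x"
  using assms by (simp add: orbit_eq_equivclp equivclp_class_eq_iff equivclp_sym)

lemma set_support_eq_orbit: "permutation f \<Longrightarrow> set (support f x) = Orbits.orbit f x"
  by (subst support_set) (auto simp: orbit_altdef_permutation)

lemma length_support_eq_card_orbit:
  assumes "permutation f"
  shows "length (support f x) = card (Orbits.orbit f x)"
  using distinct_card[OF cycle_of_permutation[OF assms]] set_support_eq_orbit[OF assms] by metis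

lemma finite_orbit_permutation: "permutation f \<Longrightarrow> finite (Orbits.orbit f x)"
  by (rule finite_orbit[OF permutation_self_in_orbit])

lemma size_cycle_type: "size (cycle_type A f) = card (cycles A f)"
  by (simp add: cycle_type_def)

lemma sum_mset_cycle_type:
  assumes "f permutes A" "finite A"
  shows "sum_mset (cycle_type A f) = card A"
proof -
  have "partition_on A (cycles A f)" using assms by (rule partition_on_cycles)
  moreover have "finite C" if "C \<in> cycles A f" for C
    using that assms permutation_permutes by (auto simp: cycles_def intro: finite_orbit_permutation)
  ultimately have "card (\<Union> (cycles A f)) = sum card (cycles A f)"
    by (intro card_Union_disjoint) (auto dest: partition_onD2)
  moreover have "\<Union> (cycles A f) = A" using \<open>partition_on A _\<close> by (auto dest: partition_onD1)
  ultimately show ?thesis by (simp add: cycle_type_def sum_unfold_sum_mset)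
qed

lemma pos_cycle_type:
  assumes "f permutes A" "finite A" "z \<in># cycle_type A f"
  shows "1 \<le> z"
proof -
  obtain x where "z = card (Orbits.orbit f x)"
    using assms by (auto simp: cycle_type_def cycles_def)
  moreover have "permutation f" using assms permutation_permutes by blast
  ultimately show ?thesis
    using orbit_nonempty[of f x] finite_orbit_permutation[of f x] by (simp add: Suc_le_eq card_gt_0_iff)
qed

text \<open>Counts the points at which a cycle of length \<open>z\<close> may start when
  \<open>f\<close> is written as a list.\<close>

lemma card_points_of_cycle_length:
  assumes "f permutes A" "finite A"
  shows "card {x \<in> A. card (Orbits.orbit f x) = z} = z * count (cycle_type A f) z"
proof -
  let ?C = "{C \<in> cycles A f. card C = z}"
  have perm: "permutation f" using assms permutation_permutes by blast
  have fin: "finite (cycles A f)" using assms by (simp add: cycles_def)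
  have part: "partition_on A (cycles A f)" using assms by (rule partition_on_cycles)
  have "{x \<in> A. card (Orbits.orbit f x) = z} = \<Union> ?C"
  proof (intro equalityI subsetI)
    fix x assume "x \<in> {x \<in> A. card (Orbits.orbit f x) = z}"
    then have "Orbits.orbit f x \<in> ?C" by (simp add: cycles_def)
    then show "x \<in> \<Union> ?C" using permutation_self_in_orbit[OF perm] by blast
  next
    fix x assume "x \<in> \<Union> ?C"
    then obtain y where y: "y \<in> A" "x \<in> Orbits.orbit f y" "card (Orbits.orbit f y) = z"
      by (auto simp: cycles_def)
    moreover from this have "Orbits.orbit f x = Orbits.orbit f y" using orbit_eq_of_mem[OF perm] by blast
    moreover have "x \<in> A" using permutes_orbit_subset[OF assms(1) y(1)] y(2) by blast
    ultimately show "x \<in> {x \<in> A. card (Orbits.orbit f x) = z}" by simp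
  qed
  also have "card (\<Union> ?C) = sum card ?C"
  proof (rule card_Union_disjoint)
    show "pairwise disjnt ?C"
      using partition_onD2[OF part] by (rule pairwise_subset) auto
    show "finite C" if "C \<in> ?C" for C
      using that by (auto simp: cycles_def intro: finite_orbit_permutation[OF perm])
  qed
  also have "\<dots> = z * card ?C" by simp
  also have "card ?C = count (cycle_type A f) z"
    unfolding cycle_type_def count_image_mset' using fin by (simp add: eq_commute conj_commute)
  finally show ?thesis .
qed

section \<open>One cycle beside a permutation of a disjoint set\<close>

context
  fixes ys :: "'a list" and B :: "'a set" and h :: "'a \<Rightarrow> 'a"
  assumes ys: "distinct ys" "ys \<noteq> []" and h: "h permutes B" "finite B" and disj: "set ys \<inter> B = {}"
begin

lemma cycle_comp_permutes: "cycle_of_list ys \<circ> h permutes set ys \<union> B"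
  using permutes_subset[OF cycle_permutes, of ys "set ys \<union> B"] permutes_subset[OF h(1), of "set ys \<union> B"]
  by (intro permutes_compose) auto

lemma cycle_comp_permutation: "permutation (cycle_of_list ys \<circ> h)"
  using cycle_comp_permutes h(2) permutation_permutes by blast

lemma cycle_comp_apply_rest:
  assumes "x \<in> B"
  shows "(cycle_of_list ys \<circ> h) x = h x"
proof -
  have "h x \<in> B" using assms h by (simp add: permutes_in_image)
  then have "h x \<notin> set ys" using disj by blast
  then show ?thesis by (simp add: id_outside_supp)
qed

text \<open>\<open>h\<close> fixes every point of \<open>ys\<close>, so the iteration from the head
  is that of the cycle alone.\<close>

lemma cycle_comp_funpow:
  "((cycle_of_list ys \<circ> h) ^^ i) (hd ys) = ys ! (i mod length ys)"
proof -
  let ?c = "cycle_of_list ys"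
  have c: "(?c ^^ i) (hd ys) = ys ! (i mod length ys)" for i
  proof -
    have "(?c ^^ i) (hd ys) = hd (map (?c ^^ i) ys)" using ys(2) by (simp add: hd_map)
    also have "\<dots> = ys ! (i mod length ys)"
      using ys by (simp add: cyclic_rotation hd_rotate_conv_nth)
    finally show ?thesis .
  qed
  have "((?c \<circ> h) ^^ i) (hd ys) = (?c ^^ i) (hd ys)"
  proof (induction i)
    case (Suc i)
    have "(?c ^^ i) (hd ys) \<in> set ys" using c[of i] ys(2) by simp
    then have "(?c ^^ i) (hd ys) \<notin> B" using disj by blast
    with Suc h show ?case by (simp add: permutes_not_in)
  qed simp
  with c show ?thesis by simp
qed

lemma orbit_cycle_comp:
  assumes "x \<in> set ys"
  shows "Orbits.orbit (cycle_of_list ys \<circ> h) x = set ys"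
proof -
  let ?f = "cycle_of_list ys \<circ> h"
  have "Orbits.orbit ?f (hd ys) = set ys"
  proof (intro equalityI subsetI)
    fix y assume "y \<in> Orbits.orbit ?f (hd ys)"
    then obtain i where "y = (?f ^^ i) (hd ys)"
      unfolding orbit_altdef_permutation[OF cycle_comp_permutation] by blast
    then show "y \<in> set ys" using ys(2) by (simp only: cycle_comp_funpow) simp
  next
    fix y assume "y \<in> set ys"
    then obtain i where "i < length ys" "y = ys ! i" by (auto simp: in_set_conv_nth)
    then have "y = (?f ^^ i) (hd ys)" by (simp only: cycle_comp_funpow mod_less)
    then show "y \<in> Orbits.orbit ?f (hd ys)"
      unfolding orbit_altdef_permutation[OF cycle_comp_permutation] by blast
  qed
  then show ?thesis using orbit_eq_of_mem[OF cycle_comp_permutation, of x "hd ys"] assms by simp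
qed

lemma orbit_cycle_comp_rest:
  assumes "x \<in> B"
  shows "Orbits.orbit (cycle_of_list ys \<circ> h) x = Orbits.orbit h x"
proof (rule orbit_cong)
  show "x \<in> Orbits.orbit h x"
    using h permutation_permutes by (intro permutation_self_in_orbit) blast
  show "(cycle_of_list ys \<circ> h) y = h y" if "y \<in> Orbits.orbit h x" for y
    using that permutes_orbit_subset[OF h(1) assms] by (intro cycle_comp_apply_rest) blast
qed

lemma cycle_type_cycle_comp:
  "cycle_type (set ys \<union> B) (cycle_of_list ys \<circ> h) = add_mset (length ys) (cycle_type B h)"
proof -
  let ?f = "cycle_of_list ys \<circ> h"
  have "cycles (set ys) ?f = {set ys}"
    unfolding cycles_def using ys(2) by (simp add: orbit_cycle_comp image_constant_conv cong: image_cong)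
  moreover have "cycles B ?f = cycles B h"
    unfolding cycles_def by (intro image_cong refl orbit_cycle_comp_rest)
  ultimately have "cycles (set ys \<union> B) ?f = insert (set ys) (cycles B h)"
    unfolding cycles_def image_Un by simp
  moreover have "set ys \<notin> cycles B h"
  proof
    assume "set ys \<in> cycles B h"
    then obtain x where "x \<in> B" "set ys = Orbits.orbit h x" by (auto simp: cycles_def)
    with permutes_orbit_subset[OF h(1)] have "set ys \<subseteq> B" by blast
    with disj ys(2) show False by (cases ys) auto
  qed
  ultimately show ?thesis
    using h(2) ys(1) by (simp add: cycle_type_def cycles_def distinct_card)
qed

text \<open>The permutation and the starting point determine the whole list \<open>ys\<close>,
  because iteration visits the cycle in the order of the list.\<close>

lemma support_cycle_comp: "support (cycle_of_list ys \<circ> h) (hd ys) = ys"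
proof (rule nth_equalityI)
  show len: "length (support (cycle_of_list ys \<circ> h) (hd ys)) = length ys"
    unfolding length_support_eq_card_orbit[OF cycle_comp_permutation]
    using ys by (subst orbit_cycle_comp) (simp_all add: distinct_card)
  fix i assume "i < length (support (cycle_of_list ys \<circ> h) (hd ys))"
  then have i: "i < length ys" unfolding len .
  have "support (cycle_of_list ys \<circ> h) (hd ys) ! i = ((cycle_of_list ys \<circ> h) ^^ i) (hd ys)"
    using i len by simp
  also have "\<dots> = ys ! i"
    using i unfolding cycle_comp_funpow by (simp only: mod_less)
  finally show "support (cycle_of_list ys \<circ> h) (hd ys) ! i = ys ! i" .
qed

lemma perm_restrict_cycle_comp: "perm_restrict (cycle_of_list ys \<circ> h) B = h"
proof
  fix x
  show "perm_restrict (cycle_of_list ys \<circ> h) B x = h x"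
    using cycle_comp_apply_rest[of x] h(1) by (cases "x \<in> B") (simp_all add: perm_restrict_def permutes_not_in)
qed

end

section \<open>Writing a permutation as a list cut into cycles\<close>

lemma perm_of_cut_permutes: "perm_of_cut \<zeta> xs permutes set xs"
proof (induction \<zeta> arbitrary: xs)
  case Nil
  show ?case using permutes_id by (simp add: id_def)
next
  case (Cons z \<zeta>)
  have "perm_of_cut \<zeta> (drop z xs) permutes set xs"
    by (rule permutes_subset[OF Cons set_drop_subset])
  moreover have "cycle_of_list (take z xs) permutes set xs"
    by (rule permutes_subset[OF cycle_permutes set_take_subset])
  ultimately show ?case unfolding perm_of_cut.simps by (rule permutes_compose)
qed

lemma perm_of_cut_permutes_and_type:
  assumes "distinct xs" "length xs = sum_list \<zeta>" "\<forall>z\<in>set \<zeta>. 1 \<le> z"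
  shows "perm_of_cut \<zeta> xs permutes set xs \<and> cycle_type (set xs) (perm_of_cut \<zeta> xs) = mset \<zeta>"
  using assms
proof (induction \<zeta> arbitrary: xs)
  case Nil
  then show ?case by (simp add: cycle_type_def cycles_def id_def)
next
  case (Cons z \<zeta>)
  let ?ys = "take z xs" and ?xs = "drop z xs"
  have IH: "perm_of_cut \<zeta> ?xs permutes set ?xs" "cycle_type (set ?xs) (perm_of_cut \<zeta> ?xs) = mset \<zeta>"
    using Cons.prems by (auto intro!: Cons.IH[THEN conjunct1] Cons.IH[THEN conjunct2])
  have ys: "distinct ?ys" "?ys \<noteq> []" "set ?ys \<inter> set ?xs = {}" "length ?ys = z"
    using Cons.prems by (auto simp: set_take_disj_set_drop_if_distinct)
  have "set ?ys \<union> set ?xs = set xs" by (metis append_take_drop_id set_append)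
  then show ?case
    using cycle_comp_permutes[OF ys(1,2) IH(1) _ ys(3)] cycle_type_cycle_comp[OF ys(1,2) IH(1) _ ys(3)] IH(2) ys(4)
    by (simp add: comp_def)
qed

text \<open>All ways of writing \<open>f\<close> in cycle notation with bracket lengths prescribed
  in this order.\<close>

definition cut_lists :: "'a set \<Rightarrow> ('a \<Rightarrow> 'a) \<Rightarrow> nat list \<Rightarrow> 'a list set" where
  "cut_lists A f \<zeta> = {xs. distinct xs \<and> set xs = A \<and> length xs = sum_list \<zeta> \<and> perm_of_cut \<zeta> xs = f}"

lemma split_off_orbit:
  assumes "f permutes A" "finite A" "x \<in> A"
  defines "h \<equiv> perm_restrict f (A - Orbits.orbit f x)"
  shows "f = cycle_of_list (support f x) \<circ> h" and "h permutes A - Orbits.orbit f x"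
proof -
  have perm: "permutation f" using assms permutation_permutes by blast
  show h: "h permutes A - Orbits.orbit f x"
    unfolding h_def using cyclic_on_orbit[OF assms(1,2)] by (rule perm_restrict_diff_cyclic[OF assms(1)])
  show "f = cycle_of_list (support f x) \<circ> h"
  proof
    fix y
    show "f y = (cycle_of_list (support f x) \<circ> h) y"
    proof (cases "y \<in> A - Orbits.orbit f x")
      case True
      then have "h y = f y" by (simp add: h_def perm_restrict_def)
      moreover have "h y \<notin> set (support f x)"
        using True permutes_in_image[OF h, of y] set_support_eq_orbit[OF perm] by auto
      ultimately show ?thesis by (metis comp_apply id_outside_supp)
    next
      case False
      then have "h y = y" unfolding h_def by (rule perm_restrict_simps(2))
      moreover have "f y = cycle_of_list (support f x) y"
      proof (cases "y \<in> Orbits.orbit f x")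
        case True
        then show ?thesis using set_support_eq_orbit[OF perm] by (intro cycle_restrict[OF perm]) simp
      next
        case False
        with \<open>y \<notin> A - _\<close> have "y \<notin> A" by blast
        moreover have "y \<notin> set (support f x)" using False set_support_eq_orbit[OF perm] by simp
        ultimately show ?thesis using permutes_not_in[OF assms(1)] id_outside_supp by metis
      qed
      ultimately show ?thesis by (simp only: comp_apply)
    qed
  qed
qed

text \<open>The head \<open>x\<close> must lie on a cycle of length \<open>z\<close> and forces the
  first segment, which is the cycle read from \<open>x\<close>. What follows is any such list for
  the restriction of \<open>f\<close> to the remaining points.\<close>

lemma cut_lists_Cons:
  assumes "f permutes A" "finite A" "1 \<le> z"
  shows "cut_lists A f (z # \<zeta>) = (\<Union>x\<in>{x \<in> A. card (Orbits.orbit f x) = z}.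
    (@) (support f x) ` cut_lists (A - Orbits.orbit f x) (perm_restrict f (A - Orbits.orbit f x)) \<zeta>)"
    (is "_ = (\<Union>x\<in>?X. ?L x)")
proof (intro equalityI subsetI)
  have perm: "permutation f" using assms permutation_permutes by blast
  note len = length_support_eq_card_orbit[OF perm] and set = set_support_eq_orbit[OF perm]
  {
    fix xs assume "xs \<in> (\<Union>x\<in>?X. ?L x)"
    then obtain x xs' where x: "x \<in> A" "card (Orbits.orbit f x) = z" and xs: "xs = support f x @ xs'"
      and xs': "distinct xs'" "set xs' = A - Orbits.orbit f x" "length xs' = sum_list \<zeta>"
        "perm_of_cut \<zeta> xs' = perm_restrict f (A - Orbits.orbit f x)"
      by (auto simp: cut_lists_def)
    have [simp]: "length (support f x) = z" using len x by simp
    have "distinct xs" unfolding xs distinct_append set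
      using xs' cycle_of_permutation[OF perm] by blast
    moreover have "set xs = A" unfolding xs set_append set
      using xs' permutes_orbit_subset[OF assms(1) x(1)] by blast
    moreover have "length xs = sum_list (z # \<zeta>)"
      unfolding xs length_append using xs'(3) len[of x] x(2) by simp
    moreover have "take z xs = support f x" "drop z xs = xs'"
      unfolding xs using len[of x] x(2) by (simp_all only: take_append drop_append) simp_all
    then have "perm_of_cut (z # \<zeta>) xs = f"
      using split_off_orbit(1)[OF assms(1,2) x(1)] xs'(4) by (simp only: perm_of_cut.simps)
    ultimately show "xs \<in> cut_lists A f (z # \<zeta>)" by (simp add: cut_lists_def)
  }
  {
    fix xs assume "xs \<in> cut_lists A f (z # \<zeta>)"
    then have xs: "distinct xs" "set xs = A" "length xs = z + sum_list \<zeta>"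
      and f: "f = cycle_of_list (take z xs) \<circ> perm_of_cut \<zeta> (drop z xs)"
      by (auto simp: cut_lists_def)
    define ys xs' h where "ys = take z xs" and "xs' = drop z xs" and "h = perm_of_cut \<zeta> (drop z xs)"
    have ys: "distinct ys" "ys \<noteq> []" "length ys = z"
      using xs assms(3) by (auto simp: ys_def)
    have xs': "distinct xs'" "length xs' = sum_list \<zeta>" "set ys \<inter> set xs' = {}"
      using xs by (auto simp: xs'_def ys_def set_take_disj_set_drop_if_distinct)
    have split: "xs = ys @ xs'" by (simp add: ys_def xs'_def)
    have f: "f = cycle_of_list ys \<circ> h" using f by (simp only: ys_def h_def)
    have h: "h permutes set xs'" unfolding h_def xs'_def by (rule perm_of_cut_permutes)
    note cyc = ys(1,2) h finite_set xs'(3)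
    have x: "hd ys \<in> A" "hd ys \<in> set ys" using xs(2) ys(2) by (auto simp: split)
    have orbit: "Orbits.orbit f (hd ys) = set ys" unfolding f by (rule orbit_cycle_comp[OF cyc x(2)])
    have rest: "A - set ys = set xs'" using xs(2) xs'(3) by (auto simp: split)
    have "support f (hd ys) = ys" unfolding f by (rule support_cycle_comp[OF cyc])
    moreover have "perm_restrict f (set xs') = h" unfolding f by (rule perm_restrict_cycle_comp[OF cyc])
    ultimately have "xs \<in> ?L (hd ys)"
      using xs' unfolding orbit rest split by (simp add: cut_lists_def h_def xs'_def[symmetric])
    moreover have "hd ys \<in> ?X" using x ys orbit by (simp add: distinct_card)
    ultimately show "xs \<in> (\<Union>x\<in>?X. ?L x)" by blast
  }
qed

lemma finite_cut_lists: "finite (cut_lists A f \<zeta>)"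
proof (cases "finite A")
  case True
  have "cut_lists A f \<zeta> \<subseteq> {xs. set xs \<subseteq> A \<and> length xs = sum_list \<zeta>}" by (auto simp: cut_lists_def)
  then show ?thesis using finite_lists_length_eq[OF True] by (rule finite_subset)
next
  case False
  then have "set xs \<noteq> A" for xs by auto
  then show ?thesis by (simp add: cut_lists_def)
qed

text \<open>
  The lists are counted by choosing the point that starts the first cycle: it can be any of the
  points on the cycles of length \<open>z\<close>.
\<close>
lemma card_cut_lists:
  assumes "f permutes A" "finite A" "cycle_type A f = mset \<zeta>"
  shows "card (cut_lists A f \<zeta>) = centralizer_size \<zeta>"
  using assms
proof (induction \<zeta> arbitrary: A f)
  case Nil
  then have "A = {}" by (simp add: cycle_type_def cycles_def mset_set_empty_iff)
  with Nil have "cut_lists A f [] = {[]}" by (auto simp: cut_lists_def)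
  then show ?case by simp
next
  case (Cons z \<zeta>)
  note f = Cons.prems(1,2)
  let ?X = "{x \<in> A. card (Orbits.orbit f x) = z}"
  let ?O = "Orbits.orbit f" and ?h = "\<lambda>x. perm_restrict f (A - Orbits.orbit f x)"
  let ?L = "\<lambda>x. cut_lists (A - ?O x) (?h x) \<zeta>"
  have perm: "permutation f" using f permutation_permutes by blast
  have "1 \<le> z" using pos_cycle_type[OF f] Cons.prems(3) by simp
  have L: "card (?L x) = centralizer_size \<zeta>" if "x \<in> ?X" for x
  proof (rule Cons.IH)
    have x: "x \<in> A" "card (?O x) = z" using that by auto
    note split = split_off_orbit[OF f x(1)] and set = set_support_eq_orbit[OF perm, of x]
    show "?h x permutes A - ?O x" by (rule split(2))
    show "finite (A - ?O x)" using f by simp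
    have "?O x \<subseteq> A" using permutes_orbit_subset[OF f(1) x(1)] .
    moreover have "support f x \<noteq> []" using set orbit_nonempty[of f x] by (metis set_empty)
    then have "cycle_type (set (support f x) \<union> (A - ?O x)) (cycle_of_list (support f x) \<circ> ?h x) =
        add_mset (length (support f x)) (cycle_type (A - ?O x) (?h x))"
      using cycle_of_permutation[OF perm] split(2) f(2) set by (intro cycle_type_cycle_comp) auto
    \<comment> \<open>Removing the cycle through \<open>x\<close> removes one part \<open>z\<close>
      from the cycle type.\<close>
    ultimately have "cycle_type A f = add_mset z (cycle_type (A - ?O x) (?h x))"
      unfolding split(1)[symmetric] set length_support_eq_card_orbit[OF perm] x(2)
      by (simp add: Un_absorb1)
    then show "cycle_type (A - ?O x) (?h x) = mset \<zeta>" using Cons.prems(3) by simp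
  qed
  \<comment> \<open>The starting point is recovered as the head, so different starting points give
    disjoint sets of lists.\<close>
  have hd: "hd xs = x" if "x \<in> ?X" "xs \<in> (@) (support f x) ` ?L x" for x xs
    using that least_power_of_permutation(2)[OF perm, of x] by (auto simp: hd_append hd_map)
  have "card (cut_lists A f (z # \<zeta>)) = (\<Sum>x\<in>?X. card ((@) (support f x) ` ?L x))"
    unfolding cut_lists_Cons[OF f \<open>1 \<le> z\<close>]
  proof (rule card_UN_disjoint)
    show "finite ?X" using f by simp
    show "\<forall>x\<in>?X. finite ((@) (support f x) ` ?L x)" by (simp add: finite_cut_lists)
    show "\<forall>x\<in>?X. \<forall>y\<in>?X. x \<noteq> y \<longrightarrow> (@) (support f x) ` ?L x \<inter> (@) (support f y) ` ?L y = {}"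
    proof (intro ballI impI equals0I)
      fix x y xs assume xy: "x \<in> ?X" "y \<in> ?X" "x \<noteq> y"
        and "xs \<in> (@) (support f x) ` ?L x \<inter> (@) (support f y) ` ?L y"
      then have "hd xs = x" "hd xs = y" using hd[OF xy(1), of xs] hd[OF xy(2), of xs] by blast+
      with xy(3) show False by simp
    qed
  qed
  also have "\<dots> = (\<Sum>x\<in>?X. centralizer_size \<zeta>)"
    using L by (intro sum.cong refl) (simp add: card_image inj_on_def)
  also have "\<dots> = z * count_list (z # \<zeta>) z * centralizer_size \<zeta>"
    using card_points_of_cycle_length[OF f, of z] Cons.prems(3) by (simp add: count_mset)
  finally show ?case by simp
qed

text \<open>Conjugation relabels the entries of every cycle.\<close>

lemma conjugation_perm_of_cut:
  assumes "distinct xs" "bij p"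
  shows "p \<circ> perm_of_cut \<zeta> xs \<circ> inv_into UNIV p = perm_of_cut \<zeta> (map p xs)"
  using assms(1)
proof (induction \<zeta> arbitrary: xs)
  case Nil
  show ?case using assms(2) by (simp add: fun_eq_iff bij_is_surj surj_f_inv_f)
next
  case (Cons z \<zeta>)
  have "p \<circ> perm_of_cut (z # \<zeta>) xs \<circ> inv_into UNIV p =
    (p \<circ> cycle_of_list (take z xs) \<circ> inv_into UNIV p) \<circ> (p \<circ> perm_of_cut \<zeta> (drop z xs) \<circ> inv_into UNIV p)"
    using assms(2) by (simp add: fun_eq_iff bij_is_inj)
  also have "\<dots> = perm_of_cut (z # \<zeta>) (map p xs)"
  proof -
    have "p \<circ> perm_of_cut \<zeta> (drop z xs) \<circ> inv_into UNIV p = perm_of_cut \<zeta> (map p (drop z xs))"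
      using Cons.prems by (intro Cons.IH) simp
    moreover have "p \<circ> cycle_of_list (take z xs) \<circ> inv_into UNIV p = cycle_of_list (map p (take z xs))"
      using Cons.prems assms(2) by (intro conjugation_of_cycle) simp
    ultimately show ?thesis by (simp only: perm_of_cut.simps take_map drop_map)
  qed
  finally show ?case .
qed

section \<open>Canonical permutations and sums over conjugacy classes\<close>

lemma canonical_perm_from_eq_perm_of_cut:
  "canonical_perm_from s \<zeta> = perm_of_cut \<zeta> [s + 1..<s + sum_list \<zeta> + 1]"
proof (induction \<zeta> arbitrary: s)
  case (Cons z \<zeta>)
  have "take z [s + 1..<s + sum_list (z # \<zeta>) + 1] = [s + 1..<s + z + 1]"
    by (simp add: take_upt del: upt_Suc)
  moreover have "drop z [s + 1..<s + sum_list (z # \<zeta>) + 1] = [s + z + 1..<s + z + sum_list \<zeta> + 1]"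
    by (simp add: add_ac del: upt_Suc)
  ultimately show ?case using Cons[of "s + z"] by (simp only: canonical_perm_from.simps perm_of_cut.simps)
qed simp

lemma canonical_perm_eq_perm_of_cut: "canonical_perm \<zeta> = perm_of_cut \<zeta> [1..<sum_list \<zeta> + 1]"
  unfolding canonical_perm_def canonical_perm_from_eq_perm_of_cut by simp

text \<open>Prepending \<open>z\<close> raises its multiplicity by one and so multiplies its
  factorial by the new multiplicity. Values of \<open>I\<close> that do not occur contribute
  \<open>fact 0 = 1\<close>, so one index set serves the whole induction.\<close>

lemma centralizer_size_eq:
  assumes "finite I" "set \<zeta> \<subseteq> I"
  shows "centralizer_size \<zeta> = (\<Prod>i<length \<zeta>. \<zeta> ! i) * (\<Prod>i\<in>I. fact (count_list \<zeta> i))"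
  using assms(2)
proof (induction \<zeta>)
  case (Cons z \<zeta>)
  then have z: "z \<in> I" by simp
  have "(\<Prod>i\<in>I. fact (count_list (z # \<zeta>) i)) =
    fact (count_list (z # \<zeta>) z) * (\<Prod>i\<in>I - {z}. fact (count_list \<zeta> i) :: nat)"
    using assms(1) z by (subst prod.remove[of _ z]) (auto intro!: prod.cong)
  also have "\<dots> = count_list (z # \<zeta>) z * (\<Prod>i\<in>I. fact (count_list \<zeta> i))"
    using assms(1) z by (subst (2) prod.remove[of _ z]) (auto simp: algebra_simps)
  finally have "(\<Prod>i\<in>I. fact (count_list (z # \<zeta>) i)) =
    count_list (z # \<zeta>) z * (\<Prod>i\<in>I. fact (count_list \<zeta> i) :: nat)" .
  moreover have "(\<Prod>i<length (z # \<zeta>). (z # \<zeta>) ! i) = z * (\<Prod>i<length \<zeta>. \<zeta> ! i)"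
    by (simp only: length_Cons prod.lessThan_Suc_shift) simp
  ultimately show ?case using Cons by (simp add: mult_ac del: count_list.simps)
qed simp

lemma centralizer_size_pos: "\<forall>z\<in>set \<zeta>. 1 \<le> z \<Longrightarrow> 0 < centralizer_size \<zeta>"
  by (induction \<zeta>) auto

lemma finite_int_partitions: "finite (int_partitions n)"
proof (rule finite_subset)
  show "int_partitions n \<subseteq> {\<zeta>. set \<zeta> \<subseteq> {..n} \<and> length \<zeta> \<le> n}"
  proof
    fix \<zeta> assume "\<zeta> \<in> int_partitions n"
    then have *: "\<forall>i\<in>set \<zeta>. 1 \<le> i" "sum_list \<zeta> = n" by (auto simp: int_partitions_def)
    have "length \<zeta> \<le> sum_list \<zeta>" using *(1) by (induction \<zeta>) auto
    with * show "\<zeta> \<in> {\<zeta>. set \<zeta> \<subseteq> {..n} \<and> length \<zeta> \<le> n}"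
      by (auto dest: member_le_sum_list)
  qed
  show "finite {\<zeta>. set \<zeta> \<subseteq> {..n} \<and> length \<zeta> \<le> n}" by (rule finite_lists_length_le) simp
qed

lemma canonical_perm_permutes_and_type:
  assumes "\<zeta> \<in> int_partitions n"
  shows "canonical_perm \<zeta> permutes {1..n} \<and> cycle_type {1..n} (canonical_perm \<zeta>) = mset \<zeta>"
proof -
  have "set [1..<sum_list \<zeta> + 1] = {1..n}" using assms by (auto simp: int_partitions_def)
  then show ?thesis
    using perm_of_cut_permutes_and_type[of "[1..<sum_list \<zeta> + 1]" \<zeta>] assms
    unfolding canonical_perm_eq_perm_of_cut by (simp add: int_partitions_def del: upt_Suc)
qed

text \<open>Summing \<open>F\<close> over all conjugates of the canonical permutation, indexed by
  the conjugator, gives \<open>fact n\<close> equal terms. Each permutation of the type arises from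
  \<open>centralizer_size \<zeta>\<close> conjugators.\<close>

lemma sum_cycle_type_eq:
  fixes F :: "(nat \<Rightarrow> nat) \<Rightarrow> 'b :: field_char_0"
  assumes \<zeta>: "\<zeta> \<in> int_partitions n"
    and conj: "\<And>p f. p permutes {1..n} \<Longrightarrow> f permutes {1..n} \<Longrightarrow> F (p \<circ> f \<circ> inv_into UNIV p) = F f"
  shows "(\<Sum>f | f permutes {1..n} \<and> cycle_type {1..n} f = mset \<zeta>. F f) =
    fact n / of_nat (centralizer_size \<zeta>) * F (canonical_perm \<zeta>)"
proof -
  let ?A = "{1..n}" and ?c = "canonical_perm \<zeta>"
  let ?P = "{f. f permutes ?A}" and ?T = "{f. f permutes ?A \<and> cycle_type ?A f = mset \<zeta>}"
  let ?g = "\<lambda>p. p \<circ> ?c \<circ> inv_into UNIV p"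
  have sum: "sum_list \<zeta> = n" and pos: "\<forall>z\<in>set \<zeta>. 1 \<le> z" using \<zeta> by (auto simp: int_partitions_def)
  have c: "?c permutes ?A" using canonical_perm_permutes_and_type[OF \<zeta>] by blast
  have set: "set [1..<n + 1] = ?A" by auto
  have g: "?g p = perm_of_cut \<zeta> (map p [1..<n + 1])" if "p permutes ?A" for p
    unfolding canonical_perm_eq_perm_of_cut sum
    using permutes_bij[OF that] by (intro conjugation_perm_of_cut) simp_all
  have list: "distinct (map p [1..<n + 1])" "set (map p [1..<n + 1]) = ?A" "length (map p [1..<n + 1]) = sum_list \<zeta>"
    if "p permutes ?A" for p
    using permutes_inj_on[OF that] permutes_image[OF that] set sum
    by (simp_all add: distinct_map del: upt_Suc)
  \<comment> \<open>A conjugator corresponds to the list of its values; it conjugates the canonical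
    permutation to \<open>f\<close> exactly when that list, cut by \<zeta>, gives
    \<open>f\<close>.\<close>
  have fibre: "card {p \<in> ?P. ?g p = f} = centralizer_size \<zeta>" if "f \<in> ?T" for f
  proof -
    have "bij_betw (\<lambda>p. map p [1..<n + 1]) {p \<in> ?P. ?g p = f} (cut_lists ?A f \<zeta>)"
    proof (rule bij_betw_imageI)
      show "inj_on (\<lambda>p. map p [1..<n + 1]) {p \<in> ?P. ?g p = f}"
      proof (rule inj_onI)
        fix p q assume "p \<in> {p \<in> ?P. ?g p = f}" "q \<in> {p \<in> ?P. ?g p = f}"
          and eq: "map p [1..<n + 1] = map q [1..<n + 1]"
        then have pq: "p permutes ?A" "q permutes ?A" by auto
        have "p x = q x" if "x \<in> ?A" for x using eq that unfolding map_eq_conv set by blast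
        then show "p = q" using pq by (metis ext permutes_not_in)
      qed
      show "(\<lambda>p. map p [1..<n + 1]) ` {p \<in> ?P. ?g p = f} = cut_lists ?A f \<zeta>"
      proof (intro equalityI subsetI)
        fix xs assume "xs \<in> (\<lambda>p. map p [1..<n + 1]) ` {p \<in> ?P. ?g p = f}"
        then obtain p where p: "p permutes ?A" "?g p = f" "xs = map p [1..<n + 1]" by auto
        then show "xs \<in> cut_lists ?A f \<zeta>"
          using list[OF p(1)] g[OF p(1)] unfolding cut_lists_def p(3) by (intro CollectI conjI) simp_all
      next
        fix xs assume "xs \<in> cut_lists ?A f \<zeta>"
        then have xs: "distinct xs" "set xs = ?A" "length xs = n" "perm_of_cut \<zeta> xs = f"
          using sum by (auto simp: cut_lists_def)
        \<comment> \<open>The conjugator with value list \<open>xs\<close>; the shift by one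
          reconciles points from 1 with list positions from 0.\<close>
        define p where "p x = (if x \<in> ?A then xs ! (x - 1) else x)" for x
        have "bij_betw (\<lambda>x. x - 1) ?A {..<n}"
          by (rule bij_betw_byWitness[of _ Suc]) auto
        then have "bij_betw ((!) xs \<circ> (\<lambda>x. x - 1)) ?A ?A"
          using bij_betw_nth[OF xs(1), of "{..<n}" ?A] xs(2,3) by (auto intro: bij_betw_trans)
        then have "bij_betw p ?A ?A"
          by (rule bij_betw_cong[THEN iffD1, rotated]) (simp add: p_def)
        then have p: "p permutes ?A" by (rule bij_imp_permutes) (auto simp: p_def)
        have "map p [1..<n + 1] = xs"
          using xs(3) by (intro nth_equalityI) (simp_all add: p_def del: upt_Suc)
        with p g[OF p] xs(4) show "xs \<in> (\<lambda>p. map p [1..<n + 1]) ` {p \<in> ?P. ?g p = f}"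
          by (intro image_eqI[of _ _ p]) simp_all
      qed
    qed
    then have "card {p \<in> ?P. ?g p = f} = card (cut_lists ?A f \<zeta>)" by (rule bij_betw_same_card)
    then show ?thesis using card_cut_lists[of f ?A \<zeta>] that by simp
  qed
  have "fact n * F ?c = (\<Sum>p\<in>?P. F (?g p))"
    using conj[OF _ c] card_permutations[of ?A n] by simp
  also have "\<dots> = (\<Sum>f\<in>?T. \<Sum>p\<in>{p \<in> ?P. ?g p = f}. F (?g p))"
  proof (rule sum.group[symmetric])
    show "finite ?P" by (simp add: finite_permutations)
    then show "finite ?T" by (rule rev_finite_subset) auto
    show "?g ` ?P \<subseteq> ?T"
    proof
      fix f assume "f \<in> ?g ` ?P"
      then obtain p where p: "p permutes ?A" "f = perm_of_cut \<zeta> (map p [1..<n + 1])" using g by auto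
      then show "f \<in> ?T"
        using perm_of_cut_permutes_and_type[OF list(1,3)[OF p(1)] pos] list(2)[OF p(1)] by simp
    qed
  qed
  also have "\<dots> = of_nat (centralizer_size \<zeta>) * (\<Sum>f\<in>?T. F f)"
    using fibre unfolding sum_distrib_left by (intro sum.cong refl) simp
  finally show ?thesis using centralizer_size_pos[OF pos] by (simp add: field_simps)
qed

text \<open>Each permutation has exactly one integer partition as its cycle type, and on each class
  the preceding count applies.\<close>

lemma sum_permutations_by_cycle_type:
  fixes F :: "(nat \<Rightarrow> nat) \<Rightarrow> 'b :: field_char_0"
  assumes "\<And>p f. p permutes {1..n} \<Longrightarrow> f permutes {1..n} \<Longrightarrow> F (p \<circ> f \<circ> inv_into UNIV p) = F f"
  shows "(\<Sum>f | f permutes {1..n}. F f) =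
    (\<Sum>\<zeta>\<in>int_partitions n. fact n / of_nat (centralizer_size \<zeta>) * F (canonical_perm \<zeta>))"
proof -
  let ?A = "{1..n}"
  \<comment> \<open>The sorted list is increasing, whereas integer partitions are listed
    decreasingly; hence the reversal.\<close>
  define T where "T f = rev (sorted_list_of_multiset (cycle_type ?A f))" for f
  have mset_T: "mset (T f) = cycle_type ?A f" for f by (simp add: T_def)
  have T: "T f \<in> int_partitions n" if "f permutes ?A" for f
  proof -
    have "sorted_wrt (\<ge>) (T f)" by (simp add: T_def sorted_wrt_rev)
    moreover have "\<forall>z\<in>set (T f). 1 \<le> z"
      using pos_cycle_type[OF that] mset_T[of f] by (metis finite_atLeastAtMost set_mset_mset)
    moreover have "sum_list (T f) = n"
      using sum_mset_cycle_type[OF that] mset_T[of f] by (simp flip: sum_mset_sum_list)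
    ultimately show ?thesis by (simp add: int_partitions_def)
  qed
  have T_iff: "T f = \<zeta> \<longleftrightarrow> cycle_type ?A f = mset \<zeta>" if "\<zeta> \<in> int_partitions n" for f \<zeta>
  proof
    assume "cycle_type ?A f = mset \<zeta>"
    then have "mset (rev (T f)) = mset (rev \<zeta>)" by (simp add: mset_T)
    moreover have "sorted (rev (T f))" "sorted (rev \<zeta>)"
      using that by (auto simp: T_def int_partitions_def sorted_wrt_rev)
    ultimately have "rev (T f) = rev \<zeta>" by (metis properties_for_sort)
    then show "T f = \<zeta>" by simp
  qed (use mset_T in auto)
  have "(\<Sum>f | f permutes ?A. F f) = (\<Sum>\<zeta>\<in>int_partitions n. \<Sum>f\<in>{f \<in> {f. f permutes ?A}. T f = \<zeta>}. F f)"
    by (rule sum.group[symmetric]) (use T in \<open>auto simp: finite_permutations finite_int_partitions\<close>)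
  also have "\<dots> = (\<Sum>\<zeta>\<in>int_partitions n. \<Sum>f | f permutes ?A \<and> cycle_type ?A f = mset \<zeta>. F f)"
    using T_iff by (intro sum.cong refl) auto
  also have "\<dots> = (\<Sum>\<zeta>\<in>int_partitions n. fact n / of_nat (centralizer_size \<zeta>) * F (canonical_perm \<zeta>))"
    by (intro sum.cong refl sum_cycle_type_eq assms)
  finally show ?thesis .
qed

section \<open>Conjugation invariance\<close>

lemma cycle_partition_eq_cycles: "cycle_partition n f = cycles {1..n} f"
  by (simp add: cycle_partition_def cycles_def)

lemma cycles_conj:
  assumes p: "p permutes A" and f: "f permutes A" "finite A"
  shows "cycles A (p \<circ> f \<circ> inv_into UNIV p) = (`) p ` cycles A f"
proof -
  have perm: "permutation f" using f permutation_permutes by blast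
  have "p ` Orbits.orbit f x = Orbits.orbit (p \<circ> f \<circ> inv_into UNIV p) (p x)" for x
    using permutes_inverses(2)[OF p] by (intro orbit_inverse permutation_self_in_orbit perm) simp
  then have "(`) p ` cycles A f = Orbits.orbit (p \<circ> f \<circ> inv_into UNIV p) ` p ` A"
    unfolding cycles_def image_image by (intro image_cong refl)
  then show ?thesis by (simp only: cycles_def permutes_image[OF p])
qed

lemma card_image_partition: "inj p \<Longrightarrow> card ((`) p ` P) = card P"
  by (intro card_image) (simp add: inj_image_eq_iff inj_on_def)

lemma block_prod_image: "inj p \<Longrightarrow> block_prod u ((`) p ` P) = block_prod u P"
  unfolding block_prod_def
  by (subst prod.reindex)
    (auto simp: inj_image_eq_iff inj_on_def intro!: prod.cong arg_cong[of _ _ u] card_image)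

lemma conj_permutes:
  assumes "p permutes A" "f permutes A"
  shows "p \<circ> f \<circ> inv_into UNIV p permutes A"
  using assms by (intro permutes_compose permutes_inv)

text \<open>Applying \<open>p\<close> to a path for the old pair gives a path for the conjugated
  pair.\<close>

lemma transitive_pair_conj:
  assumes p: "p permutes {1..n}" and f: "f permutes {1..n}" and h: "h permutes {1..n}"
    and "transitive_pair n f h"
  shows "transitive_pair n (p \<circ> f \<circ> inv_into UNIV p) (p \<circ> h \<circ> inv_into UNIV p)"
proof -
  let ?r = "sup (arrow f) (arrow h)"
  let ?s = "sup (arrow (p \<circ> f \<circ> inv_into UNIV p)) (arrow (p \<circ> h \<circ> inv_into UNIV p))"
  note inv = permutes_inverses[OF p]
  have map: "equivclp ?s (p x) (p y)" if "equivclp ?r x y" for x y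
    using that
  proof (induction rule: equivclp_induct)
    case (step y z)
    have "?s (p a) (p b)" if "?r a b" for a b using that inv by (auto simp: arrow_def)
    with step.hyps have "?s (p y) (p z) \<or> ?s (p z) (p y)" by blast
    with step.IH show ?case by (rule equivclp_into_equivclp)
  qed (rule equivclp_refl)
  have "equivclp ?s i j" if "i \<in> {1..n}" "j \<in> {1..n}" for i j
  proof -
    have "inv_into UNIV p i \<in> {1..n}" "inv_into UNIV p j \<in> {1..n}"
      using that permutes_in_image[OF permutes_inv[OF p]] by blast+
    then have "equivclp ?r (inv_into UNIV p i) (inv_into UNIV p j)"
      using assms(4) unfolding transitive_pair_iff[OF f h] by blast
    from map[OF this] show ?thesis by (simp only: inv)
  qed
  then show ?thesis
    unfolding transitive_pair_iff[OF conj_permutes[OF p f] conj_permutes[OF p h]] by blast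
qed

section \<open>Factorizations of a permutation\<close>

text \<open>The left factors of transitive factorizations of \<gamma> with \<open>m\<close> cycles
  in total. No genus appears: it is determined by \<open>m\<close> and the cycle number of
  \<gamma>.\<close>

definition factors :: "nat \<Rightarrow> nat \<Rightarrow> (nat \<Rightarrow> nat) \<Rightarrow> (nat \<Rightarrow> nat) set" where
  "factors n m \<gamma> = {\<alpha>. \<alpha> permutes {1..n} \<and> transitive_pair n \<alpha> \<gamma> \<and>
    num_cycles n \<alpha> + num_cycles n (inv_into UNIV \<alpha> \<circ> \<gamma>) = m}"

definition weight :: "(nat \<Rightarrow> complex) \<Rightarrow> (nat \<Rightarrow> complex) \<Rightarrow> nat \<Rightarrow> (nat \<Rightarrow> nat) \<Rightarrow> (nat \<Rightarrow> nat) \<Rightarrow> complex" where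
  "weight u v n \<alpha> \<beta> = block_prod u (cycle_partition n \<alpha>) * block_prod v (cycle_partition n \<beta>)"

lemma num_cycles_conj:
  assumes "p permutes {1..n}" "f permutes {1..n}"
  shows "num_cycles n (p \<circ> f \<circ> inv_into UNIV p) = num_cycles n f"
  unfolding num_cycles_def cycle_partition_eq_cycles cycles_conj[OF assms finite_atLeastAtMost]
  by (rule card_image_partition[OF permutes_inj[OF assms(1)]])

lemma weight_conj:
  assumes "p permutes {1..n}" "f permutes {1..n}" "h permutes {1..n}"
  shows "weight u v n (p \<circ> f \<circ> inv_into UNIV p) (p \<circ> h \<circ> inv_into UNIV p) = weight u v n f h"
  unfolding weight_def cycle_partition_eq_cycles cycles_conj[OF assms(1,2) finite_atLeastAtMost]
    cycles_conj[OF assms(1,3) finite_atLeastAtMost] block_prod_image[OF permutes_inj[OF assms(1)]] ..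

lemma inv_conj_comp:
  assumes "p permutes A" "f permutes A"
  shows "inv_into UNIV (p \<circ> f \<circ> inv_into UNIV p) \<circ> (p \<circ> h \<circ> inv_into UNIV p) =
    p \<circ> (inv_into UNIV f \<circ> h) \<circ> inv_into UNIV p"
proof -
  have "inv_into UNIV (p \<circ> f \<circ> inv_into UNIV p) = p \<circ> inv_into UNIV f \<circ> inv_into UNIV p"
    using permutes_inverses[OF assms(1)] permutes_inverses[OF assms(2)]
    by (intro inv_unique_comp) (simp_all add: fun_eq_iff)
  then show ?thesis using permutes_inverses[OF assms(1)] by (simp add: fun_eq_iff)
qed

lemma conj_in_factors:
  assumes p: "p permutes {1..n}" and \<gamma>: "\<gamma> permutes {1..n}" and "\<alpha> \<in> factors n m \<gamma>"
  shows "p \<circ> \<alpha> \<circ> inv_into UNIV p \<in> factors n m (p \<circ> \<gamma> \<circ> inv_into UNIV p)"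
proof -
  have \<alpha>: "\<alpha> permutes {1..n}" "transitive_pair n \<alpha> \<gamma>"
    "num_cycles n \<alpha> + num_cycles n (inv_into UNIV \<alpha> \<circ> \<gamma>) = m"
    using assms(3) by (auto simp: factors_def)
  have "inv_into UNIV \<alpha> \<circ> \<gamma> permutes {1..n}" using \<alpha>(1) \<gamma> by (intro permutes_compose permutes_inv)
  then show ?thesis
    unfolding factors_def inv_conj_comp[OF p \<alpha>(1)] mem_Collect_eq
    using num_cycles_conj[OF p] \<alpha> conj_permutes[OF p \<alpha>(1)] transitive_pair_conj[OF p \<alpha>(1) \<gamma> \<alpha>(2)]
    by presburger
qed

text \<open>Conjugation by \<open>p\<close> is a bijection between the two sets of factors and
  preserves weights. So the inner sum is a class function of \<gamma>, as the summation by cycle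
  type requires.\<close>

lemma sum_factors_conj:
  assumes p: "p permutes {1..n}" and \<gamma>: "\<gamma> permutes {1..n}"
  shows "(\<Sum>\<alpha>\<in>factors n m (p \<circ> \<gamma> \<circ> inv_into UNIV p).
      weight u v n \<alpha> (inv_into UNIV \<alpha> \<circ> (p \<circ> \<gamma> \<circ> inv_into UNIV p))) =
    (\<Sum>\<alpha>\<in>factors n m \<gamma>. weight u v n \<alpha> (inv_into UNIV \<alpha> \<circ> \<gamma>))"
proof -
  let ?q = "inv_into UNIV p"
  have q: "?q permutes {1..n}" and qq: "inv_into UNIV ?q = p"
    using p by (simp_all add: permutes_inv permutes_inv_inv)
  have cancel: "p \<circ> (?q \<circ> f \<circ> p) \<circ> ?q = f" "?q \<circ> (p \<circ> f \<circ> ?q) \<circ> p = f" for f :: "nat \<Rightarrow> nat"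
    using permutes_inverses[OF p] by (simp_all add: fun_eq_iff)
  show ?thesis
  proof (rule sum.reindex_bij_witness[of _ "\<lambda>\<alpha>. ?q \<circ> \<alpha> \<circ> p" "\<lambda>\<alpha>. p \<circ> \<alpha> \<circ> ?q", symmetric], goal_cases)
    case (5 \<alpha>)
    then have \<alpha>: "\<alpha> permutes {1..n}" by (simp add: factors_def)
    then have "inv_into UNIV \<alpha> \<circ> \<gamma> permutes {1..n}" using \<gamma> by (intro permutes_compose permutes_inv)
    then show ?case
      unfolding inv_conj_comp[OF p \<alpha>] by (rule weight_conj[OF p \<alpha>])
  qed (use conj_in_factors[OF p \<gamma>] conj_in_factors[OF q conj_permutes[OF p \<gamma>], unfolded qq cancel] cancel in auto)
qed

lemma num_cycles_canonical_perm:
  "\<zeta> \<in> int_partitions n \<Longrightarrow> num_cycles n (canonical_perm \<zeta>) = length \<zeta>"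
  using canonical_perm_permutes_and_type[of \<zeta> n] size_cycle_type[of "{1..n}" "canonical_perm \<zeta>"]
  by (simp add: num_cycles_def cycle_partition_eq_cycles)

text \<open>Transitivity leaves one component, so the Euler inequality bounds the total cycle number
  by \<open>n + 2\<close>; parity makes the defect an even number \<open>2 * g\<close>.\<close>

lemma transitive_genus_exists:
  assumes "1 \<le> n" "\<gamma> permutes {1..n}" "\<alpha> permutes {1..n}" "transitive_pair n \<alpha> \<gamma>"
  shows "\<exists>g. has_genus n \<gamma> \<alpha> g"
proof -
  let ?\<beta> = "inv_into UNIV \<alpha> \<circ> \<gamma>" and ?A = "{1..n}"
  have arith: "\<exists>g. n + 2 = N + 2 * g" if "N \<le> n + 2" "even (n + N)" for N
    using that by presburger
  have \<beta>: "?\<beta> permutes ?A" using assms by (intro permutes_compose permutes_inv)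
  have \<gamma>: "\<alpha> \<circ> ?\<beta> = \<gamma>" using permutes_inverses[OF assms(3)] by (simp add: fun_eq_iff)
  have "transitive_pair n \<alpha> ?\<beta>" using transitive_pair_comp[OF assms(3) \<beta>] assms(4) \<gamma> by simp
  then have "comps ?A (sup (arrow \<alpha>) (arrow ?\<beta>)) = {?A}"
    unfolding transitive_pair_iff_join[OF assms(3) \<beta> assms(1)] join_cycles[OF assms(3) \<beta>]
      top_set_partitions[OF assms(1)] .
  then have "num_cycles n \<alpha> + num_cycles n ?\<beta> + num_cycles n \<gamma> \<le> n + 2"
    using euler_inequality[OF assms(3) \<beta>] by (simp add: num_cycles_def cycle_partition_eq_cycles \<gamma>)
  moreover have "even (n + num_cycles n \<alpha> + num_cycles n ?\<beta> + num_cycles n \<gamma>)"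
    using even_euler_characteristic[OF assms(3) \<beta>] by (simp add: num_cycles_def cycle_partition_eq_cycles \<gamma>)
  ultimately have "\<exists>g. n + 2 = num_cycles n \<alpha> + num_cycles n ?\<beta> + num_cycles n \<gamma> + 2 * g"
    using arith[of "num_cycles n \<alpha> + num_cycles n ?\<beta> + num_cycles n \<gamma>"] by (simp only: add.assoc)
  then obtain g where "n + 2 = num_cycles n \<alpha> + num_cycles n ?\<beta> + num_cycles n \<gamma> + 2 * g" ..
  then have "int (n + 2) = int (num_cycles n \<alpha> + num_cycles n ?\<beta> + num_cycles n \<gamma> + 2 * g)" by (rule arg_cong)
  then have "has_genus n \<gamma> \<alpha> g" by (simp add: has_genus_def)
  then show ?thesis ..
qed

text \<open>Since the canonical permutation has \<open>length \<zeta>\<close> cycles, the genus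
  equation turns the total \<open>n + 1 - k\<close> into the condition that
  \<open>length \<zeta>\<close> is \<open>k + 1 - 2 * g\<close>.\<close>

lemma factors_canonical_perm:
  assumes "1 \<le> n" "k \<le> n - 1" and \<zeta>: "\<zeta> \<in> int_partitions n"
  shows "factors n (n + 1 - k) (canonical_perm \<zeta>) =
    (\<Union>g\<in>{g. g \<in> {0..k div 2} \<and> int (length \<zeta>) = int k + 1 - 2 * int g}. S_NC g \<zeta>)"
proof -
  let ?c = "canonical_perm \<zeta>"
  have sum: "sum_list \<zeta> = n" using \<zeta> by (simp add: int_partitions_def)
  have c: "?c permutes {1..n}" using canonical_perm_permutes_and_type[OF \<zeta>] by blast
  \<comment> \<open>At least one part is what bounds the genus by \<open>k div 2\<close>.\<close>
  have "length \<zeta> \<ge> 1" using sum assms(1) by (cases \<zeta>) auto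
  note len = num_cycles_canonical_perm[OF \<zeta>]
  have genus: "num_cycles n \<alpha> + num_cycles n (inv_into UNIV \<alpha> \<circ> ?c) = n + 1 - k \<longleftrightarrow>
      g \<in> {0..k div 2} \<and> int (length \<zeta>) = int k + 1 - 2 * int g" if "has_genus n ?c \<alpha> g" for \<alpha> g
    using that \<open>length \<zeta> \<ge> 1\<close> assms(1,2) unfolding has_genus_def len by auto
  show ?thesis
  proof (intro equalityI subsetI)
    fix \<alpha> assume "\<alpha> \<in> factors n (n + 1 - k) ?c"
    moreover from this obtain g where "has_genus n ?c \<alpha> g"
      using transitive_genus_exists[OF assms(1) c] by (auto simp: factors_def)
    ultimately show "\<alpha> \<in> (\<Union>g\<in>{g. g \<in> {0..k div 2} \<and> int (length \<zeta>) = int k + 1 - 2 * int g}. S_NC g \<zeta>)"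
      using genus[of \<alpha> g] by (auto simp: factors_def S_NC_def sum)
  next
    fix \<alpha> assume "\<alpha> \<in> (\<Union>g\<in>{g. g \<in> {0..k div 2} \<and> int (length \<zeta>) = int k + 1 - 2 * int g}. S_NC g \<zeta>)"
    then obtain g where g: "g \<in> {0..k div 2}" "int (length \<zeta>) = int k + 1 - 2 * int g" "\<alpha> \<in> S_NC g \<zeta>"
      by blast
    then show "\<alpha> \<in> factors n (n + 1 - k) ?c"
      using genus[of \<alpha> g] by (simp add: factors_def S_NC_def sum)
  qed
qed

text \<open>The length of \<zeta> admits at most one \<open>g\<close>, so the union is disjoint. The
  sum over \<open>g\<close> is kept in order to be exchanged with the sum over \<zeta>.\<close>

lemma sum_factors_canonical_perm:
  assumes "1 \<le> n" "k \<le> n - 1" and \<zeta>: "\<zeta> \<in> int_partitions n"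
  shows "(\<Sum>\<alpha>\<in>factors n (n + 1 - k) (canonical_perm \<zeta>). F \<alpha>) =
    (\<Sum>g\<in>{g. g \<in> {0..k div 2} \<and> int (length \<zeta>) = int k + 1 - 2 * int g}. \<Sum>\<alpha>\<in>S_NC g \<zeta>. F \<alpha>)"
  unfolding factors_canonical_perm[OF assms]
proof (rule sum.UNION_disjoint)
  show "finite {g. g \<in> {0..k div 2} \<and> int (length \<zeta>) = int k + 1 - 2 * int g}" by simp
  have "finite (S_NC g \<zeta>)" for g
    by (rule finite_subset[OF _ finite_permutations[of "{1..sum_list \<zeta>}"]]) (auto simp: S_NC_def)
  then show "\<forall>g\<in>{g. g \<in> {0..k div 2} \<and> int (length \<zeta>) = int k + 1 - 2 * int g}. finite (S_NC g \<zeta>)"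
    by blast
  show "\<forall>g\<in>{g. g \<in> {0..k div 2} \<and> int (length \<zeta>) = int k + 1 - 2 * int g}.
    \<forall>h\<in>{g. g \<in> {0..k div 2} \<and> int (length \<zeta>) = int k + 1 - 2 * int g}. g \<noteq> h \<longrightarrow> S_NC g \<zeta> \<inter> S_NC h \<zeta> = {}"
    by auto
qed

section \<open>From pairs of partitions to pairs of permutations\<close>

definition transitive_pairs :: "nat \<Rightarrow> nat \<Rightarrow> ((nat \<Rightarrow> nat) \<times> (nat \<Rightarrow> nat)) set" where
  "transitive_pairs n m = {(\<alpha>, \<beta>). \<alpha> permutes {1..n} \<and> \<beta> permutes {1..n} \<and>
    transitive_pair n \<alpha> \<beta> \<and> num_cycles n \<alpha> + num_cycles n \<beta> = m}"

lemma finite_transitive_pairs: "finite (transitive_pairs n m)"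
  by (rule finite_subset[of _ "{\<alpha>. \<alpha> permutes {1..n}} \<times> {\<beta>. \<beta> permutes {1..n}}"])
    (auto simp: transitive_pairs_def finite_permutations)

lemma finite_factors: "finite (factors n m \<gamma>)"
  by (rule finite_subset[OF _ finite_permutations[of "{1..n}"]]) (auto simp: factors_def)

text \<open>Change of variables from (\<alpha>, \<beta>) to the product \<gamma> and \<alpha>;
  transitivity is unaffected because the generated group is the same.\<close>

lemma sum_transitive_pairs:
  "(\<Sum>(\<alpha>, \<beta>)\<in>transitive_pairs n m. W \<alpha> \<beta>) =
    (\<Sum>\<gamma> | \<gamma> permutes {1..n}. \<Sum>\<alpha>\<in>factors n m \<gamma>. W \<alpha> (inv_into UNIV \<alpha> \<circ> \<gamma>))"
proof -
  let ?P = "{\<gamma>. \<gamma> permutes {1..n}}"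
  have inv: "inv_into UNIV \<alpha> \<circ> (\<alpha> \<circ> \<beta>) = \<beta>" "\<alpha> \<circ> (inv_into UNIV \<alpha> \<circ> \<beta>) = \<beta>"
    if "\<alpha> permutes {1..n}" for \<alpha> \<beta> :: "nat \<Rightarrow> nat"
    using permutes_inverses[OF that] by (simp_all add: fun_eq_iff)
  have "(\<Sum>\<gamma>\<in>?P. \<Sum>\<alpha>\<in>factors n m \<gamma>. W \<alpha> (inv_into UNIV \<alpha> \<circ> \<gamma>)) =
    (\<Sum>(\<gamma>, \<alpha>)\<in>Sigma ?P (factors n m). W \<alpha> (inv_into UNIV \<alpha> \<circ> \<gamma>))"
    by (intro sum.Sigma) (auto simp: finite_permutations finite_factors)
  also have "\<dots> = (\<Sum>(\<alpha>, \<beta>)\<in>transitive_pairs n m. W \<alpha> \<beta>)"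
  proof (rule sum.reindex_bij_witness[of _ "\<lambda>(\<alpha>, \<beta>). (\<alpha> \<circ> \<beta>, \<alpha>)" "\<lambda>(\<gamma>, \<alpha>). (\<alpha>, inv_into UNIV \<alpha> \<circ> \<gamma>)"], goal_cases)
    case (2 x)
    obtain \<gamma> \<alpha> where [simp]: "x = (\<gamma>, \<alpha>)" by (cases x)
    have \<gamma>: "\<gamma> permutes {1..n}" and \<alpha>: "\<alpha> permutes {1..n}" "transitive_pair n \<alpha> \<gamma>"
      "num_cycles n \<alpha> + num_cycles n (inv_into UNIV \<alpha> \<circ> \<gamma>) = m"
      using 2 by (auto simp: factors_def)
    have "inv_into UNIV \<alpha> \<circ> \<gamma> permutes {1..n}" using \<alpha>(1) \<gamma> by (intro permutes_compose permutes_inv)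
    then show ?case
      using transitive_pair_comp[of \<alpha> n "inv_into UNIV \<alpha> \<circ> \<gamma>"] \<alpha> inv[OF \<alpha>(1)]
      by (simp add: transitive_pairs_def)
  next
    case (4 x)
    then obtain \<alpha> \<beta> where "x = (\<alpha>, \<beta>)" "\<alpha> permutes {1..n}" "\<beta> permutes {1..n}"
      "transitive_pair n \<alpha> \<beta>" "num_cycles n \<alpha> + num_cycles n \<beta> = m"
      by (auto simp: transitive_pairs_def)
    then show ?case
      using transitive_pair_comp[of \<alpha> n \<beta>] inv[of \<alpha>] by (simp add: factors_def permutes_compose)
  qed (auto simp: factors_def transitive_pairs_def inv)
  finally show ?thesis by simp
qed

text \<open>Both Moebius values are expanded as signed sums over permutations with the given cycle
  partitions. The weight depends only on these partitions, and the join condition becomes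
  transitivity.\<close>

lemma sum_moebius_eq_sum_transitive_pairs:
  assumes "1 \<le> n"
  shows "(\<Sum>(\<sigma>, \<tau>) \<in> {(\<sigma>, \<tau>). \<sigma> \<in> carrier (set_partitions n) \<and> \<tau> \<in> carrier (set_partitions n) \<and>
            \<sigma> \<squnion>\<^bsub>set_partitions n\<^esub> \<tau> = \<top>\<^bsub>set_partitions n\<^esub> \<and> card \<sigma> + card \<tau> = m}.
         of_int (moebius (set_partitions n) \<bottom>\<^bsub>set_partitions n\<^esub> \<sigma>) *
         of_int (moebius (set_partitions n) \<bottom>\<^bsub>set_partitions n\<^esub> \<tau>) *
         block_prod u \<sigma> * block_prod v \<tau>) =
    (\<Sum>(\<alpha>, \<beta>)\<in>transitive_pairs n m. (-1) ^ m * weight u v n \<alpha> \<beta>)" (is "sum ?f ?X = _")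
proof -
  let ?A = "{1..n}" and ?L = "set_partitions n"
  let ?g = "\<lambda>(\<alpha>, \<beta>). (cycles ?A \<alpha>, cycles ?A \<beta>)"
  let ?C = "\<lambda>\<sigma>. {\<alpha>. \<alpha> permutes ?A \<and> cycles ?A \<alpha> = \<sigma>}"
  have part: "cycles ?A \<alpha> \<in> carrier ?L" if "\<alpha> permutes ?A" for \<alpha>
    unfolding carrier_set_partitions by (intro partition_on_cycles that finite_atLeastAtMost)
  \<comment> \<open>Each sign has exponent \<open>n\<close> plus a cycle number; the two copies of
    \<open>n\<close> cancel modulo 2.\<close>
  have sign: "of_int (sign \<alpha>) * of_int (sign \<beta>) = ((-1) ^ m :: complex)"
    if "(\<alpha>, \<beta>) \<in> transitive_pairs n m" for \<alpha> \<beta>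
  proof -
    have *: "\<alpha> permutes ?A" "\<beta> permutes ?A" "card (cycles ?A \<alpha>) + card (cycles ?A \<beta>) = m"
      using that by (auto simp: transitive_pairs_def num_cycles_def cycle_partition_eq_cycles)
    have "sign \<alpha> * sign \<beta> = (-1) ^ (n + card (cycles ?A \<alpha>)) * (-1) ^ (n + card (cycles ?A \<beta>))"
      using sign_eq_card_cycles[OF *(1)] sign_eq_card_cycles[OF *(2)] by simp
    also have "\<dots> = (-1) ^ m" unfolding *(3)[symmetric] by (simp add: power_add)
    finally have "of_int (sign \<alpha> * sign \<beta>) = (of_int ((-1) ^ m) :: complex)" by simp
    then show ?thesis by simp
  qed
  have "sum ?f ?X = (\<Sum>x\<in>?X. \<Sum>(\<alpha>, \<beta>)\<in>{y \<in> transitive_pairs n m. ?g y = x}. (-1) ^ m * weight u v n \<alpha> \<beta>)"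
  proof (rule sum.cong[OF refl])
    fix x assume "x \<in> ?X"
    then obtain \<sigma> \<tau> where [simp]: "x = (\<sigma>, \<tau>)" and \<sigma>: "\<sigma> \<in> carrier ?L" and \<tau>: "\<tau> \<in> carrier ?L"
      and st: "\<sigma> \<squnion>\<^bsub>?L\<^esub> \<tau> = \<top>\<^bsub>?L\<^esub>" "card \<sigma> + card \<tau> = m" by auto
    \<comment> \<open>Transitivity and the cycle count depend only on the two cycle partitions, so
      the fibre is a full product and the double sum factorizes.\<close>
    have fibre: "{y \<in> transitive_pairs n m. ?g y = (\<sigma>, \<tau>)} = ?C \<sigma> \<times> ?C \<tau>"
    proof -
      have "(\<alpha>, \<beta>) \<in> transitive_pairs n m" if "\<alpha> \<in> ?C \<sigma>" "\<beta> \<in> ?C \<tau>" for \<alpha> \<beta>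
        using that st transitive_pair_iff_join[of \<alpha> n \<beta>] assms
        by (auto simp: transitive_pairs_def num_cycles_def cycle_partition_eq_cycles)
      then show ?thesis by (auto simp: transitive_pairs_def)
    qed
    have "?f (\<sigma>, \<tau>) = (\<Sum>\<alpha>\<in>?C \<sigma>. of_int (sign \<alpha>)) * (\<Sum>\<beta>\<in>?C \<tau>. of_int (sign \<beta>)) *
        (block_prod u \<sigma> * block_prod v \<tau>)"
      using moebius_set_partitions[OF \<sigma>] moebius_set_partitions[OF \<tau>] by (simp add: of_int_sum)
    also have "\<dots> = (\<Sum>(\<alpha>, \<beta>)\<in>?C \<sigma> \<times> ?C \<tau>. of_int (sign \<alpha>) * of_int (sign \<beta>) * (block_prod u \<sigma> * block_prod v \<tau>))"
      by (subst sum_product) (simp only: sum.cartesian_product sum_distrib_right case_prod_unfold)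
    also have "\<dots> = (\<Sum>(\<alpha>, \<beta>)\<in>{y \<in> transitive_pairs n m. ?g y = (\<sigma>, \<tau>)}. (-1) ^ m * weight u v n \<alpha> \<beta>)"
      unfolding fibre[symmetric] using sign
      by (intro sum.cong refl) (auto simp: weight_def cycle_partition_eq_cycles)
    finally show "?f x = (\<Sum>(\<alpha>, \<beta>)\<in>{y \<in> transitive_pairs n m. ?g y = x}. (-1) ^ m * weight u v n \<alpha> \<beta>)"
      by simp
  qed
  also have "\<dots> = (\<Sum>(\<alpha>, \<beta>)\<in>transitive_pairs n m. (-1) ^ m * weight u v n \<alpha> \<beta>)"
  proof (rule sum.group[OF finite_transitive_pairs])
    show "finite ?X"
      by (rule finite_subset[of _ "carrier ?L \<times> carrier ?L"]) (auto simp: finite_set_partitions)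
    show "?g ` transitive_pairs n m \<subseteq> ?X"
      using part transitive_pair_iff_join assms
      by (auto simp: transitive_pairs_def num_cycles_def cycle_partition_eq_cycles)
  qed
  finally show ?thesis .
qed

theorem theorem4p3:
  fixes u v :: "nat \<Rightarrow> complex" and n k :: nat
  assumes "n \<ge> 1" and "k \<le> n - 1"
  shows "(-1) ^ (n - 1) / fact (n - 1) *
      (\<Sum>(\<sigma>, \<tau>) \<in> {(\<sigma>, \<tau>). \<sigma> \<in> carrier (set_partitions n) \<and> \<tau> \<in> carrier (set_partitions n) \<and>
            \<sigma> \<squnion>\<^bsub>set_partitions n\<^esub> \<tau> = \<top>\<^bsub>set_partitions n\<^esub> \<and> card \<sigma> + card \<tau> = n + 1 - k}.
         of_int (moebius (set_partitions n) \<bottom>\<^bsub>set_partitions n\<^esub> \<sigma>) *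
         of_int (moebius (set_partitions n) \<bottom>\<^bsub>set_partitions n\<^esub> \<tau>) *
         block_prod u \<sigma> * block_prod v \<tau>)
    = (-1) ^ k * (\<Sum>g = 0..k div 2. s_coeff u v n k g)"
proof -
  let ?m = "n + 1 - k" and ?c = canonical_perm
  let ?R = "\<lambda>g \<zeta>. int (length \<zeta>) = int k + 1 - 2 * int g"
  let ?S = "\<lambda>g \<zeta>. \<Sum>\<alpha>\<in>S_NC g \<zeta>. weight u v n \<alpha> (inv_into UNIV \<alpha> \<circ> ?c \<zeta>)"
  let ?q = "\<lambda>\<zeta>. of_nat n / of_nat (centralizer_size \<zeta>) :: complex"
  \<comment> \<open>Splits the class size into the numerator \<open>n\<close> of
    \<open>s_coeff\<close> and a factor that cancels the prefactor.\<close>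
  have "fact n / fact (n - 1) = (of_nat n :: complex)"
    using assms(1) by (simp add: fact_reduce)
  then have coeff: "fact n / of_nat (centralizer_size \<zeta>) = fact (n - 1) * ?q \<zeta>" for \<zeta>
    by (simp add: field_simps)
  have s: "s_coeff u v n k g = (\<Sum>\<zeta>\<in>{\<zeta>. \<zeta> \<in> int_partitions n \<and> ?R g \<zeta>}. ?q \<zeta> * ?S g \<zeta>)" for g
    unfolding s_coeff_def
  proof (rule sum.cong)
    fix \<zeta> assume "\<zeta> \<in> {\<zeta>. \<zeta> \<in> int_partitions n \<and> ?R g \<zeta>}"
    then have "set \<zeta> \<subseteq> {1..n}" by (auto simp: int_partitions_def dest: member_le_sum_list)
    then have "of_nat (centralizer_size \<zeta>) =
      of_nat (\<Prod>i<length \<zeta>. \<zeta> ! i) * (\<Prod>i=1..n. fact (count_list \<zeta> i) :: complex)"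
      by (subst centralizer_size_eq[of "{1..n}"]) simp_all
    then show "of_nat n / (of_nat (\<Prod>i<length \<zeta>. \<zeta> ! i) * (\<Prod>i=1..n. fact (count_list \<zeta> i))) *
        (\<Sum>\<alpha>\<in>S_NC g \<zeta>. block_prod u (cycle_partition n \<alpha>) *
          block_prod v (cycle_partition n (inv_into UNIV \<alpha> \<circ> ?c \<zeta>))) = ?q \<zeta> * ?S g \<zeta>"
      by (simp only: weight_def)
  qed simp
  have "(\<Sum>(\<alpha>, \<beta>)\<in>transitive_pairs n ?m. weight u v n \<alpha> \<beta>) =
      (\<Sum>\<zeta>\<in>int_partitions n. fact n / of_nat (centralizer_size \<zeta>) *
        (\<Sum>\<alpha>\<in>factors n ?m (?c \<zeta>). weight u v n \<alpha> (inv_into UNIV \<alpha> \<circ> ?c \<zeta>)))"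
    unfolding sum_transitive_pairs
    by (rule sum_permutations_by_cycle_type) (rule sum_factors_conj)
  also have "\<dots> = (\<Sum>\<zeta>\<in>int_partitions n. \<Sum>g\<in>{g. g \<in> {0..k div 2} \<and> ?R g \<zeta>}. fact (n - 1) * (?q \<zeta> * ?S g \<zeta>))"
    unfolding coeff
    by (intro sum.cong refl, subst sum_factors_canonical_perm[OF assms]) (simp_all add: sum_distrib_left mult_ac)
  \<comment> \<open>The condition linking \<zeta> and \<open>g\<close> is symmetric in its role as a
    restriction, so the sums may be exchanged.\<close>
  also have "\<dots> = (\<Sum>g = 0..k div 2. \<Sum>\<zeta>\<in>{\<zeta>. \<zeta> \<in> int_partitions n \<and> ?R g \<zeta>}. fact (n - 1) * (?q \<zeta> * ?S g \<zeta>))"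
    by (rule sum.swap_restrict[symmetric]) (simp_all add: finite_int_partitions)
  also have "\<dots> = fact (n - 1) * (\<Sum>g = 0..k div 2. s_coeff u v n k g)"
    unfolding s sum_distrib_left ..
  finally have main: "(\<Sum>(\<alpha>, \<beta>)\<in>transitive_pairs n ?m. weight u v n \<alpha> \<beta>) =
    fact (n - 1) * (\<Sum>g = 0..k div 2. s_coeff u v n k g)" .
  have "(-1 :: complex) ^ (n - 1) * (-1) ^ ?m = (-1) ^ (n - 1 + ?m)" by (simp only: power_add)
  \<comment> \<open>The bound on \<open>k\<close> keeps both subtractions exact, and the even part
    disappears from the sign.\<close>
  also have "n - 1 + ?m = k + 2 * (n - k)" using assms by simp
  finally have sign: "(-1 :: complex) ^ (n - 1) * (-1) ^ ?m = (-1) ^ k" by (simp add: power_add power_mult)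
  have "(\<Sum>(\<alpha>, \<beta>)\<in>transitive_pairs n ?m. (-1) ^ ?m * weight u v n \<alpha> \<beta>) =
    (-1) ^ ?m * (\<Sum>(\<alpha>, \<beta>)\<in>transitive_pairs n ?m. weight u v n \<alpha> \<beta>)"
    by (simp only: sum_distrib_left case_prod_unfold)
  then have "(-1) ^ (n - 1) / fact (n - 1) * (\<Sum>(\<alpha>, \<beta>)\<in>transitive_pairs n ?m. (-1) ^ ?m * weight u v n \<alpha> \<beta>) =
    (-1) ^ (n - 1) * (-1) ^ ?m / fact (n - 1) * (\<Sum>(\<alpha>, \<beta>)\<in>transitive_pairs n ?m. weight u v n \<alpha> \<beta>)"
    by (simp only: times_divide_eq_left mult.assoc)
  also have "\<dots> = (-1) ^ k * (\<Sum>g = 0..k div 2. s_coeff u v n k g)"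
    unfolding main sign by simp
  finally show ?thesis unfolding sum_moebius_eq_sum_transitive_pairs[OF assms(1)] .
qed

end
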